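(* Let $N$ be a lattice of finite rank, $M=\operatorname{Hom}(N,\mathbb{Z})$, $\Sigma$ a complete fan in $N_{\mathbb{R}}=N\otimes_{\mathbb{Z}}\mathbb{R}$, and $X=X(\Sigma)$ the corresponding toric variety over a field. Let $q\ge 2$ and $n\ge 2$ be integers. For $1\le i\le n-1$ let $\Delta_i = X^{i-1}\times\Delta\times X^{n-i-1}\subset X^n$, where $\Delta\subset X\times X$ is the diagonal, and let $L_i\subset M^n$ be the sublattice of tuples $(u_1,\dots,u_n)$ such that $u_1+\cdots+u_n=0$ and $u_j=0$ for all $j\notin\{i,i+1\}$. Then a splitting of $X^n$ at $q$ given by $$\pi=\sum_{a\in\frac{1}{q}M^n} c_a\pi_a$$ is compatible with $\Delta_1\cup\cdots\cup\Delta_{n-1}$ if and only if, for every $1\le i\le n-1$, for any $b$ and $b'$ in $\frac{1}{q}M^n$ such that $b\equiv b'$ mod $\frac{1}{q}L_i$, and for any class $[u]\in M^n/L_i$, we have $$\sum_{\substack{a\in \frac{1}{q}M^n,\ a+b\in M^n\\ (a+b)\bmod L_i=[u]}} c_a \;=\; \sum_{\substack{a'\in \frac{1}{q}M^n,\ a'+b'\in M^n\\ (a'+b')\bmod L_i=[u]}} c_{a'}.$$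
   Context: Let $Y$ be the toric variety over a field $k$ of a complete fan $\Sigma_Y$ in $(N_Y)_{\mathbb{R}}$, with dense torus $T_Y$ and character lattice $M_Y=\operatorname{Hom}(N_Y,\mathbb{Z})$. (The theorem uses $Y=X^n$, with $N_Y=N^n$, $M_Y=M^n$, the product fan and torus $T^n$.) For an integer $q\ge 2$, multiplication by $q$ on $(N_Y)_{\mathbb{R}}$ preserves $\Sigma_Y$ and induces a morphism $F\colon Y\to Y$. A splitting of $Y$ at $q$ is an $\mathcal{O}_Y$-module map $\pi\colon F_*\mathcal{O}_Y\to\mathcal{O}_Y$ whose composition with the natural map $\mathcal{O}_Y\to F_*\mathcal{O}_Y$ is the identity. It is compatible with a subvariety $Z\subset Y$ with ideal sheaf $I_Z$ if $\pi(F_*I_Z)\subset I_Z$. The maps $\pi_a$: global sections of $F_*\mathcal{O}_{T_Y}$ are identified with the span of monomials $x^b$, $b\in\frac{1}{q}M_Y$, as a module over $k[M_Y]=\Gamma(T_Y,\mathcal{O}_{T_Y})$, so that $\mathcal{O}_{T_Y}\to F_*\mathcal{O}_{T_Y}$ is the inclusion $x^u\mapsto x^u$, $u\in M_Y$. For $a\in\frac{1}{q}M_Y$, $\pi_a\in\operatorname{Hom}(F_*\mathcal{O}_{T_Y},\mathcal{O}_{T_Y})$ is given by $\pi_a(x^b)=x^{a+b}$ if $a+b\in M_Y$, and $\pi_a(x^b)=0$ otherwise. The maps $\pi_a$ form a basis of the vector space $\operatorname{Hom}(F_*\mathcal{O}_{T_Y},\mathcal{O}_{T_Y})$. Each $\mathcal{O}_Y$-module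 map $F_*\mathcal{O}_Y\to\mathcal{O}_Y$ is determined by its restriction to $T_Y$, and hence is written as a finite sum $\sum c_a\pi_a$ with $c_a\in k$; such a sum extends to $Y$ if and only if $c_a\neq 0$ only for $a$ in the open polytope $\{u\in (M_Y)_{\mathbb{R}} : \langle u,v\rangle<1 \text{ for every primitive generator } v \text{ of a 1-dimensional cone of } \Sigma_Y\}$, and it is a splitting if and only if in addition $c_0=1$. *)

theory Defs
  imports
    Complex_Main
    "HOL-Library.Poly_Mapping"
    "HOL-Computational_Algebra.Fraction_Field"
begin

section \<open>Fans\<close>

text \<open>
  The lattice of rank \<open>r\<close> is \<open>N = \<int>\<^sup>r\<close>; its elements, and those of \<open>N\<^sub>\<real>\<close>, are sequences that
  vanish from index \<open>r\<close> on. The dual lattice \<open>M\<close> is identified with \<open>\<int>\<^sup>r\<close> through the standard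
  pairing.
\<close>

type_synonym vec = "nat \<Rightarrow> real"

definition NR :: "nat \<Rightarrow> vec set" where
  "NR r = {v. \<forall>l\<ge>r. v l = 0}"

definition lattice_points :: "nat \<Rightarrow> vec set" where
  "lattice_points r = {v \<in> NR r. \<forall>l. v l \<in> \<int>}"

definition pairing :: "nat \<Rightarrow> vec \<Rightarrow> vec \<Rightarrow> real" where
  "pairing r u v = (\<Sum>l<r. u l * v l)"

definition cone_generated :: "vec set \<Rightarrow> vec set" where
  "cone_generated S = {v. \<exists>c. (\<forall>s\<in>S. 0 \<le> c s) \<and> v = (\<lambda>l. \<Sum>s\<in>S. c s * s l)}"

definition rational_polyhedral_cone :: "nat \<Rightarrow> vec set \<Rightarrow> bool" where
  "rational_polyhedral_cone r \<sigma> \<longleftrightarrow>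
     (\<exists>S. finite S \<and> S \<subseteq> lattice_points r \<and> \<sigma> = cone_generated S)"

definition strongly_convex :: "vec set \<Rightarrow> bool" where
  "strongly_convex \<sigma> \<longleftrightarrow> (\<forall>v. v \<in> \<sigma> \<and> (\<lambda>l. - v l) \<in> \<sigma> \<longrightarrow> v = (\<lambda>l. 0))"

definition is_face :: "nat \<Rightarrow> vec set \<Rightarrow> vec set \<Rightarrow> bool" where
  "is_face r \<tau> \<sigma> \<longleftrightarrow>
     (\<exists>u\<in>NR r. (\<forall>v\<in>\<sigma>. 0 \<le> pairing r u v) \<and> \<tau> = {v \<in> \<sigma>. pairing r u v = 0})"

definition fan :: "nat \<Rightarrow> vec set set \<Rightarrow> bool" where
  "fan r \<Sigma> \<longleftrightarrow> finite \<Sigma>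
     \<and> (\<forall>\<sigma>\<in>\<Sigma>. rational_polyhedral_cone r \<sigma> \<and> strongly_convex \<sigma>)
     \<and> (\<forall>\<sigma>\<in>\<Sigma>. \<forall>\<tau>. is_face r \<tau> \<sigma> \<longrightarrow> \<tau> \<in> \<Sigma>)
     \<and> (\<forall>\<sigma>\<in>\<Sigma>. \<forall>\<sigma>'\<in>\<Sigma>. is_face r (\<sigma> \<inter> \<sigma>') \<sigma> \<and> is_face r (\<sigma> \<inter> \<sigma>') \<sigma>')"

definition complete_fan :: "nat \<Rightarrow> vec set set \<Rightarrow> bool" where
  "complete_fan r \<Sigma> \<longleftrightarrow> fan r \<Sigma> \<and> \<Union>\<Sigma> = NR r"

text \<open>
  Cones in \<open>(N\<^sup>m)\<^sub>\<real>\<close> are sets of tuples \<open>w\<close> with components \<open>w 1, \<dots>, w m \<in> N\<^sub>\<real>\<close> (and \<open>w j = 0\<close>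
  for all other \<open>j\<close>).
\<close>

definition prod_cone :: "nat \<Rightarrow> (nat \<Rightarrow> vec set) \<Rightarrow> (nat \<Rightarrow> vec) set" where
  "prod_cone m \<sigma> = {w. \<forall>j. if j \<in> {1..m} then w j \<in> \<sigma> j else w j = (\<lambda>l. 0)}"

definition prod_fan :: "nat \<Rightarrow> vec set set \<Rightarrow> (nat \<Rightarrow> vec) set set" where
  "prod_fan m \<Sigma> = {prod_cone m \<sigma> | \<sigma>. \<forall>j\<in>{1..m}. \<sigma> j \<in> \<Sigma>}"


section \<open>Exponents and monomials\<close>

text \<open>
  An exponent is a tuple \<open>(u\<^sub>1, u\<^sub>2, \<dots>)\<close> of elements of \<open>\<rat>\<^sup>r\<close>. Rational exponents are admitted
  so that \<open>M\<^sup>m\<close> and \<open>(1/q) M\<^sup>m\<close> live in one type.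
\<close>

type_synonym expo = "nat \<Rightarrow>\<^sub>0 nat \<Rightarrow>\<^sub>0 rat"

definition M_pow :: "nat \<Rightarrow> nat \<Rightarrow> expo set" where
  "M_pow r m = {u. \<forall>j l. Poly_Mapping.lookup (Poly_Mapping.lookup u j) l \<in> \<int>
     \<and> (Poly_Mapping.lookup (Poly_Mapping.lookup u j) l \<noteq> 0 \<longrightarrow> j \<in> {1..m} \<and> l < r)}"

definition scale :: "nat \<Rightarrow> expo \<Rightarrow> expo" where
  "scale q = Poly_Mapping.map (Poly_Mapping.map (\<lambda>t. of_nat q * t))"

definition frac_lattice :: "nat \<Rightarrow> expo set \<Rightarrow> expo set" where
  "frac_lattice q L = {u. scale q u \<in> L}"

definition pairing_pow :: "nat \<Rightarrow> nat \<Rightarrow> expo \<Rightarrow> (nat \<Rightarrow> vec) \<Rightarrow> real" where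
  "pairing_pow r m u w =
     (\<Sum>j=1..m. pairing r (\<lambda>l. of_rat (Poly_Mapping.lookup (Poly_Mapping.lookup u j) l)) (w j))"

text \<open>
  \<open>'k alg\<close> is the group algebra of the group of all exponents; the coordinate rings below are
  subrings of it, and \<open>Poly_Mapping.single u 1\<close> is the monomial \<open>x\<^sup>u\<close>.
\<close>

type_synonym 'k alg = "expo \<Rightarrow>\<^sub>0 'k"

text \<open>
  \<open>push h\<close> is the linear map with \<open>x\<^sup>u \<mapsto> x\<^bsup>h u\<^esup>\<close>. It is also used below on tuples, where
  component \<open>j\<close> is moved to position \<open>h j\<close> and components that meet are added.
\<close>

definition push :: "('a \<Rightarrow> 'b) \<Rightarrow> ('a \<Rightarrow>\<^sub>0 'c) \<Rightarrow> ('b \<Rightarrow>\<^sub>0 'c::comm_monoid_add)" where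
  "push h f = (\<Sum>u\<in>Poly_Mapping.keys f. Poly_Mapping.single (h u) (Poly_Mapping.lookup f u))"

definition dual_monoid :: "nat \<Rightarrow> nat \<Rightarrow> (nat \<Rightarrow> vec) set \<Rightarrow> expo set" where
  "dual_monoid r m C = {u \<in> M_pow r m. \<forall>w\<in>C. 0 \<le> pairing_pow r m u w}"

definition coord_ring :: "nat \<Rightarrow> nat \<Rightarrow> (nat \<Rightarrow> vec) set \<Rightarrow> 'k::field alg set" where
  "coord_ring r m C = {f. Poly_Mapping.keys f \<subseteq> dual_monoid r m C}"


section \<open>Integral separated schemes glued from affine charts\<close>

text \<open>
  Let \<open>\<A>\<close> be a set of integral domains, all subrings of \<open>'k alg\<close>. The spectra of the members of
  \<open>\<A>\<close> are glued inside the field of fractions: a point is represented by its local ring, i.e. the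
  prime \<open>p\<close> of \<open>A\<close> by the localization \<open>A\<^sub>p\<close>, and points of different charts are
  identified when these subrings coincide. For an integral separated scheme, points are determined
  by their local rings, so this is the usual gluing. In particular, for a fan it identifies
  \<open>U\<^sub>\<sigma>\<close> and \<open>U\<^sub>\<tau>\<close> exactly along \<open>U\<^bsub>\<sigma> \<inter> \<tau>\<^esub>\<close>: the separating exponent \<open>u\<close> of the two
  cones has \<open>x\<^sup>u\<close> in the first ring and \<open>x\<^bsup>-u\<^esup>\<close> in the second one, so \<open>x\<^sup>u\<close> is a unit in every
  common local ring.
\<close>

type_synonym 'k pt = "'k alg fract set"

definition prime_ideal :: "'a::comm_ring_1 set \<Rightarrow> 'a set \<Rightarrow> bool" where
  "prime_ideal A p \<longleftrightarrow> p \<subseteq> A \<and> 0 \<in> p \<and> 1 \<notin> p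
     \<and> (\<forall>x\<in>p. \<forall>y\<in>p. x + y \<in> p)
     \<and> (\<forall>a\<in>A. \<forall>x\<in>p. a * x \<in> p)
     \<and> (\<forall>a\<in>A. \<forall>b\<in>A. a * b \<in> p \<longrightarrow> a \<in> p \<or> b \<in> p)"

definition local_ring :: "'k::field alg set \<Rightarrow> 'k alg set \<Rightarrow> 'k pt" where
  "local_ring A p = {Fract a b | a b. a \<in> A \<and> b \<in> A \<and> b \<notin> p}"

definition max_ideal :: "'k::field pt \<Rightarrow> 'k alg fract set" where
  "max_ideal x = {z \<in> x. z = 0 \<or> inverse z \<notin> x}"

definition basic_open :: "'k::field alg set \<Rightarrow> 'k alg \<Rightarrow> 'k pt set" where
  "basic_open A f = {local_ring A p | p. prime_ideal A p \<and> f \<notin> p}"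

definition spec :: "'k::field alg set \<Rightarrow> 'k pt set" where
  "spec A = {local_ring A p | p. prime_ideal A p}"

definition zariski_open :: "'k::field alg set set \<Rightarrow> 'k pt set \<Rightarrow> bool" where
  "zariski_open \<A> U \<longleftrightarrow> U \<subseteq> (\<Union>A\<in>\<A>. spec A)
     \<and> (\<forall>x\<in>U. \<exists>A\<in>\<A>. \<exists>f\<in>A. x \<in> basic_open A f \<and> basic_open A f \<subseteq> U)"

text \<open>
  Sections over \<open>U\<close> are functions into the stalks that are locally fractions. Outside \<open>U\<close> they
  are set to \<open>0\<close>, so that equality of sections over \<open>U\<close> is equality of functions.
\<close>

definition sections :: "'k::field alg set set \<Rightarrow> 'k pt set \<Rightarrow> ('k pt \<Rightarrow> 'k alg fract) set" where
  "sections \<A> U = {s. (\<forall>x. x \<notin> U \<longrightarrow> s x = 0)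
     \<and> (\<forall>x\<in>U. \<exists>V. zariski_open \<A> V \<and> x \<in> V \<and> V \<subseteq> U
          \<and> (\<exists>A\<in>\<A>. \<exists>a\<in>A. \<exists>b\<in>A. \<forall>y\<in>V. y \<in> basic_open A b \<and> s y = Fract a b))}"

definition res :: "'k::field pt set \<Rightarrow> ('k pt \<Rightarrow> 'k alg fract) \<Rightarrow> 'k pt \<Rightarrow> 'k alg fract" where
  "res V s = (\<lambda>x. if x \<in> V then s x else 0)"

definition ideal_sheaf ::
    "'k::field alg set set \<Rightarrow> 'k pt set \<Rightarrow> 'k pt set \<Rightarrow> ('k pt \<Rightarrow> 'k alg fract) set" where
  "ideal_sheaf \<A> Z U = {s \<in> sections \<A> U. \<forall>x\<in>U \<inter> Z. s x \<in> max_ideal x}"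


section \<open>The morphism F and splittings\<close>

text \<open>
  Multiplication by \<open>q\<close> on \<open>N\<close> maps every cone to itself; on each chart \<open>F\<close> is the map of spectra
  given by the ring map \<open>x\<^sup>u \<mapsto> x\<^bsup>qu\<^esup>\<close>.
\<close>

definition F_pt :: "nat \<Rightarrow> 'k::field alg set set \<Rightarrow> 'k pt \<Rightarrow> 'k pt" where
  "F_pt q \<A> x = (THE y. \<exists>A\<in>\<A>. \<exists>p. prime_ideal A p \<and> x = local_ring A p
     \<and> y = local_ring A {f \<in> A. push (scale q) f \<in> p})"

definition F_field :: "nat \<Rightarrow> 'k::field alg fract \<Rightarrow> 'k alg fract" where
  "F_field q z = (THE w. \<exists>a b. b \<noteq> 0 \<and> z = Fract a b
     \<and> w = Fract (push (scale q) a) (push (scale q) b))"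

definition F_preimage :: "nat \<Rightarrow> 'k::field alg set set \<Rightarrow> 'k pt set \<Rightarrow> 'k pt set" where
  "F_preimage q \<A> U = {x \<in> (\<Union>A\<in>\<A>. spec A). F_pt q \<A> x \<in> U}"

text \<open>The natural map from the structure sheaf to its direct image, on sections over \<open>U\<close>.\<close>

definition F_sharp :: "nat \<Rightarrow> 'k::field alg set set \<Rightarrow> 'k pt set
    \<Rightarrow> ('k pt \<Rightarrow> 'k alg fract) \<Rightarrow> 'k pt \<Rightarrow> 'k alg fract" where
  "F_sharp q \<A> U s = res (F_preimage q \<A> U) (\<lambda>x. F_field q (s (F_pt q \<A> x)))"

definition F_direct_image ::
    "nat \<Rightarrow> 'k::field alg set set \<Rightarrow> 'k pt set \<Rightarrow> ('k pt \<Rightarrow> 'k alg fract) set" where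
  "F_direct_image q \<A> U = sections \<A> (F_preimage q \<A> U)"

type_synonym 'k sheaf_map = "'k pt set \<Rightarrow> ('k pt \<Rightarrow> 'k alg fract) \<Rightarrow> 'k pt \<Rightarrow> 'k alg fract"

definition module_map :: "nat \<Rightarrow> 'k::field alg set set \<Rightarrow> 'k sheaf_map \<Rightarrow> bool" where
  "module_map q \<A> \<pi> \<longleftrightarrow> (\<forall>U. zariski_open \<A> U \<longrightarrow>
     (\<forall>s \<in> F_direct_image q \<A> U. \<pi> U s \<in> sections \<A> U)
   \<and> (\<forall>s \<in> F_direct_image q \<A> U. \<forall>t \<in> F_direct_image q \<A> U.
        \<pi> U (\<lambda>x. s x + t x) = (\<lambda>x. \<pi> U s x + \<pi> U t x))
   \<and> (\<forall>f \<in> sections \<A> U. \<forall>s \<in> F_direct_image q \<A> U.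
        \<pi> U (\<lambda>x. F_sharp q \<A> U f x * s x) = (\<lambda>x. f x * \<pi> U s x))
   \<and> (\<forall>V s. zariski_open \<A> V \<and> V \<subseteq> U \<and> s \<in> F_direct_image q \<A> U \<longrightarrow>
        \<pi> V (res (F_preimage q \<A> V) s) = res V (\<pi> U s)))"

definition splitting :: "nat \<Rightarrow> 'k::field alg set set \<Rightarrow> 'k sheaf_map \<Rightarrow> bool" where
  "splitting q \<A> \<pi> \<longleftrightarrow> module_map q \<A> \<pi>
     \<and> (\<forall>U. zariski_open \<A> U \<longrightarrow> (\<forall>s \<in> sections \<A> U. \<pi> U (F_sharp q \<A> U s) = s))"

definition compatible ::
    "nat \<Rightarrow> 'k::field alg set set \<Rightarrow> 'k sheaf_map \<Rightarrow> 'k pt set \<Rightarrow> bool" where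
  "compatible q \<A> \<pi> Z \<longleftrightarrow> (\<forall>U. zariski_open \<A> U \<longrightarrow>
     (\<forall>s \<in> ideal_sheaf \<A> Z (F_preimage q \<A> U). \<pi> U s \<in> ideal_sheaf \<A> Z U))"


section \<open>Powers of a toric variety, the torus and the diagonals\<close>

text \<open>The charts of \<open>X\<^sup>m\<close>, the toric variety of the product fan in \<open>N\<^sup>m\<close>.\<close>

definition charts :: "nat \<Rightarrow> vec set set \<Rightarrow> nat \<Rightarrow> 'k::field alg set set" where
  "charts r \<Sigma> m = coord_ring r m ` prod_fan m \<Sigma>"

definition torus :: "nat \<Rightarrow> nat \<Rightarrow> 'k::field pt set" where
  "torus r m = spec (coord_ring r m {\<lambda>j l. 0})"

definition torus_section :: "nat \<Rightarrow> nat \<Rightarrow> 'k::field alg \<Rightarrow> 'k pt \<Rightarrow> 'k alg fract" where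
  "torus_section r m f = res (torus r m) (\<lambda>x. Fract f 1)"

definition pi_a :: "nat \<Rightarrow> nat \<Rightarrow> expo \<Rightarrow> 'k::field alg \<Rightarrow> 'k alg" where
  "pi_a r m a f = (\<Sum>b | b \<in> Poly_Mapping.keys f \<and> a + b \<in> M_pow r m.
     Poly_Mapping.single (a + b) (Poly_Mapping.lookup f b))"

text \<open>
  \<open>\<pi>\<close> restricts to \<open>\<Sum>\<^sub>a c\<^sub>a \<pi>\<^sub>a\<close> on the torus, a finite sum over \<open>a \<in> (1/q) M\<^sup>m\<close>. As in the
  definition of \<open>\<pi>\<^sub>a\<close>, the element \<open>x\<^sup>b\<close> with \<open>b \<in> (1/q) M\<^sup>m\<close> stands for the section \<open>x\<^bsup>qb\<^esup>\<close> of
  the direct image.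
\<close>

definition given_by :: "nat \<Rightarrow> nat \<Rightarrow> nat \<Rightarrow> 'k::field sheaf_map \<Rightarrow> (expo \<Rightarrow>\<^sub>0 'k) \<Rightarrow> bool" where
  "given_by q r m \<pi> c \<longleftrightarrow> Poly_Mapping.keys c \<subseteq> frac_lattice q (M_pow r m)
     \<and> (\<forall>f. Poly_Mapping.keys f \<subseteq> frac_lattice q (M_pow r m) \<longrightarrow>
          \<pi> (torus r m) (torus_section r m (push (scale q) f))
          = torus_section r m (\<Sum>a\<in>Poly_Mapping.keys c.
              Poly_Mapping.single 0 (Poly_Mapping.lookup c a) * pi_a r m a f))"

text \<open>
  The morphism \<open>X\<^bsup>n-1\<^esup> \<rightarrow> X\<^sup>n\<close> that repeats the \<open>i\<close>-th component is
  \<open>(y\<^sub>j)\<^sub>j \<mapsto> (y\<^bsub>diag_index i j\<^esub>)\<^sub>j\<close>. It maps the chart of \<open>\<sigma>\<^sub>1 \<times> \<dots> \<times> \<sigma>\<^bsub>n-1\<^esub>\<close> to the chart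
  of the correspondingly reindexed product, and its ring map is
  \<open>x\<^bsup>(u\<^sub>1,\<dots>,u\<^sub>n)\<^esup> \<mapsto> x\<^bsup>(u\<^sub>1,\<dots>,u\<^sub>i+u\<^bsub>i+1\<^esub>,\<dots>,u\<^sub>n)\<^esup>\<close>. Its image is
  \<open>X\<^bsup>i-1\<^esup> \<times> \<Delta> \<times> X\<^bsup>n-i-1\<^esup>\<close>.
\<close>

definition diag_index :: "nat \<Rightarrow> nat \<Rightarrow> nat" where
  "diag_index i j = (if j \<le> i then j else j - 1)"

definition diagonal :: "nat \<Rightarrow> vec set set \<Rightarrow> nat \<Rightarrow> nat \<Rightarrow> 'k::field pt set" where
  "diagonal r \<Sigma> n i = {y. \<exists>\<sigma> p. (\<forall>j\<in>{1..n-1}. \<sigma> j \<in> \<Sigma>)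
     \<and> prime_ideal (coord_ring r (n-1) (prod_cone (n-1) \<sigma>)) p
     \<and> y = local_ring (coord_ring r n (prod_cone n (\<sigma> \<circ> diag_index i)))
             {f \<in> coord_ring r n (prod_cone n (\<sigma> \<circ> diag_index i)).
                push (push (diag_index i)) f \<in> p}}"

definition L_sub :: "nat \<Rightarrow> nat \<Rightarrow> nat \<Rightarrow> expo set" where
  "L_sub r n i = {u \<in> M_pow r n. (\<Sum>j=1..n. Poly_Mapping.lookup u j) = 0
     \<and> (\<forall>j. j \<notin> {i, i+1} \<longrightarrow> Poly_Mapping.lookup u j = 0)}"

end

theory Submission
  imports Defs
begin

text \<open>
  Every nonempty open set contains the generic point, so a section is a single element of the field of
  fractions, and an open set that meets a component of \<open>\<Delta>\<^sub>1 \<union> \<dots> \<union> \<Delta>\<^bsub>n-1\<^esub>\<close> contains the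
  generic point \<open>\<eta>\<^sub>i\<close> of that component, which lies on the torus. Near \<open>\<eta>\<^sub>i\<close>, a section of
  the direct image is \<open>h / F\<^sup># g\<close> with \<open>h, g\<close> in the coordinate ring of the torus and \<open>g\<close> a unit at
  \<open>\<eta>\<^sub>i\<close>, and \<open>\<pi>\<close> maps it to \<open>\<pi>(h) / g\<close>. Hence \<open>\<pi>\<close> is compatible with the union as soon as it maps
  the ideal \<open>I\<^sub>i\<close> of each \<open>\<Delta>\<^sub>i\<close> on the torus into itself. Conversely, let \<open>h \<in> I\<^sub>i\<close> and let \<open>g\<close>
  be a product of binomials, one in each \<open>I\<^sub>j\<close> with \<open>j \<noteq> i\<close> and none in \<open>I\<^sub>i\<close>. Then
  \<open>F\<^sup># g h\<close> vanishes on the union, so compatibility gives \<open>g \<pi>(h) \<in> I\<^sub>i\<close>, and \<open>I\<^sub>i\<close> is prime.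
  Finally, \<open>I\<^sub>i\<close> is the kernel of \<open>k[M\<^sup>n] \<rightarrow> k[M\<^sup>n / L\<^sub>i]\<close>, and it is preserved exactly if the
  image of \<open>\<pi>(x\<^sup>b)\<close> in \<open>k[M\<^sup>n / L\<^sub>i]\<close> depends only on the class of \<open>b\<close>; the coefficients of that
  image are the sums in the statement.
\<close>

section \<open>Push-forward of exponents\<close>

abbreviation (input) lkp :: "('a \<Rightarrow>\<^sub>0 'b::zero) \<Rightarrow> 'a \<Rightarrow> 'b" where "lkp \<equiv> Poly_Mapping.lookup"
abbreviation monomial :: "expo \<Rightarrow> 'k::field alg" where "monomial u \<equiv> Poly_Mapping.single u 1"

lemma poly_mapping_sum_single:
  "f = (\<Sum>u\<in>Poly_Mapping.keys f. Poly_Mapping.single u (lkp f u))"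
  by (rule poly_mapping_eqI) (auto simp: lookup_sum lookup_single when_def in_keys_iff)

lemma push_superset:
  assumes "finite A" "Poly_Mapping.keys f \<subseteq> A"
  shows "push h f = (\<Sum>u\<in>A. Poly_Mapping.single (h u) (lkp f u))"
  unfolding push_def using assms
  by (intro sum.mono_neutral_left) (auto simp: in_keys_iff)

lemma push_zero [simp]: "push h 0 = 0"
  by (simp add: push_def)

lemma push_single [simp]: "push h (Poly_Mapping.single u c) = Poly_Mapping.single (h u) c"
  by (cases "c = 0") (simp_all add: push_def)

lemma push_add: "push h (f + g) = push h f + push h g"
proof -
  let ?A = "Poly_Mapping.keys f \<union> Poly_Mapping.keys g"
  have "Poly_Mapping.keys (f + g) \<subseteq> ?A" by (rule keys_add)
  then show ?thesis
    by (simp add: push_superset[of ?A] lookup_add single_add sum.distrib)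
qed

lemma push_sum: "push h (sum f I) = (\<Sum>i\<in>I. push h (f i))"
  by (induction I rule: infinite_finite_induct) (simp_all add: push_add)

lemma push_uminus: "push h (- f) = - push h (f :: 'a \<Rightarrow>\<^sub>0 'c::ab_group_add)"
  using push_add[of h f "- f"] by (simp add: eq_neg_iff_add_eq_0 add.commute)

lemma push_diff: "push h (f - g) = push h f - push h (g :: 'a \<Rightarrow>\<^sub>0 'c::ab_group_add)"
  using push_add[of h f "- g"] by (simp add: push_uminus)

lemma push_push: "push g (push h f) = push (g \<circ> h) f"
  by (subst (2) push_def) (simp add: push_sum, simp add: push_def)

lemma push_ident: "(\<And>u. h u = u) \<Longrightarrow> push h f = f"
  using poly_mapping_sum_single[of f] by (simp add: push_def)

lemma push_mult:
  fixes f g :: "'a::comm_monoid_add \<Rightarrow>\<^sub>0 'c::comm_semiring_1"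
    and h :: "'a \<Rightarrow> 'b::comm_monoid_add"
  assumes "\<And>u v. h (u + v) = h u + h v"
  shows "push h (f * g) = push h f * push h g"
proof -
  have "f * g = (\<Sum>u\<in>Poly_Mapping.keys f. Poly_Mapping.single u (lkp f u))
      * (\<Sum>v\<in>Poly_Mapping.keys g. Poly_Mapping.single v (lkp g v))"
    using poly_mapping_sum_single[of f] poly_mapping_sum_single[of g] by simp
  also have "push h \<dots> = push h f * push h g"
    by (simp add: sum_product push_sum mult_single assms, simp add: push_def sum_product mult_single)
  finally show ?thesis .
qed

lemma lookup_push: "lkp (push h f) v = (\<Sum>u | u \<in> Poly_Mapping.keys f \<and> h u = v. lkp f u)"
proof -
  have "lkp (push h f) v = (\<Sum>u\<in>Poly_Mapping.keys f. if h u = v then lkp f u else 0)"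
    by (simp add: push_def lookup_sum lookup_single when_def)
  also have "\<dots> = (\<Sum>u | u \<in> Poly_Mapping.keys f \<and> h u = v. lkp f u)"
    by (rule sum.inter_filter[symmetric]) simp
  finally show ?thesis .
qed

lemma keys_push: "Poly_Mapping.keys (push h f) \<subseteq> h ` Poly_Mapping.keys f"
proof
  fix v assume "v \<in> Poly_Mapping.keys (push h f)"
  then have "(\<Sum>u | u \<in> Poly_Mapping.keys f \<and> h u = v. lkp f u) \<noteq> 0"
    by (simp add: in_keys_iff lookup_push)
  then obtain u where "u \<in> {u. u \<in> Poly_Mapping.keys f \<and> h u = v}"
    by (metis (no_types, lifting) sum.neutral empty_iff equals0I)
  then show "v \<in> h ` Poly_Mapping.keys f" by blast
qed

lemma keys_mult_subset:
  assumes "Poly_Mapping.keys f \<subseteq> S" "Poly_Mapping.keys g \<subseteq> T"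
  shows "Poly_Mapping.keys (f * g) \<subseteq> {u + v | u v. u \<in> S \<and> v \<in> T}"
  using keys_mult[of f g] assms by blast

text \<open>The inverse of \<open>scale q\<close> exists because rational exponents are admitted.\<close>

definition unscale :: "nat \<Rightarrow> expo \<Rightarrow> expo" where
  "unscale q = Poly_Mapping.map (Poly_Mapping.map (\<lambda>t. t / of_nat q))"

lemma lookup_map0: "f 0 = 0 \<Longrightarrow> lkp (Poly_Mapping.map f p) k = f (lkp p k)"
  by (cases "lkp p k = 0") (simp_all add: map.rep_eq when_def)

lemma map_zero0 [simp]: "Poly_Mapping.map f 0 = 0"
  by (simp add: map_eq_zero_iff)

lemma lookup_scale [simp]: "lkp (lkp (scale q u) j) l = of_nat q * lkp (lkp u j) l"
  by (simp add: scale_def lookup_map0)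

lemma lookup_unscale [simp]: "lkp (lkp (unscale q u) j) l = lkp (lkp u j) l / of_nat q"
  by (simp add: unscale_def lookup_map0)

lemma expo_eqI: "(\<And>j l. lkp (lkp u j) l = lkp (lkp v j) l) \<Longrightarrow> u = (v :: expo)"
  by (intro poly_mapping_eqI) auto

lemma scale_add: "scale q (u + v) = scale q u + scale q v"
  by (rule expo_eqI) (simp add: lookup_add algebra_simps)

lemma scale_diff: "scale q (u - v) = scale q u - scale q v"
  by (rule expo_eqI) (simp add: lookup_minus algebra_simps)

lemma scale_0 [simp]: "scale 0 u = 0"
  by (rule expo_eqI) simp

lemma scale_Suc: "scale (Suc q) u = u + scale q u"
  by (rule expo_eqI) (simp add: lookup_add algebra_simps)

lemma unscale_scale [simp]: "q > 0 \<Longrightarrow> unscale q (scale q u) = u"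
  by (rule expo_eqI) simp

lemma scale_unscale [simp]: "q > 0 \<Longrightarrow> scale q (unscale q u) = u"
  by (rule expo_eqI) simp

abbreviation frob :: "nat \<Rightarrow> 'k::field alg \<Rightarrow> 'k alg" where "frob q \<equiv> push (scale q)"
abbreviation unfrob :: "nat \<Rightarrow> 'k::field alg \<Rightarrow> 'k alg" where "unfrob q \<equiv> push (unscale q)"

lemma frob_mult: "frob q (f * g) = frob q f * frob q g"
  by (rule push_mult) (rule scale_add)

lemma frob_one [simp]: "frob q 1 = 1"
proof -
  have "scale q 0 = 0" by (rule expo_eqI) simp
  then show ?thesis by (simp flip: single_one)
qed

lemma unfrob_frob [simp]: "q > 0 \<Longrightarrow> unfrob q (frob q f) = f"
  by (simp add: push_push push_ident)

lemma frob_unfrob [simp]: "q > 0 \<Longrightarrow> frob q (unfrob q f) = f"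
  by (simp add: push_push push_ident)

lemma frob_eq_0_iff [simp]: "q > 0 \<Longrightarrow> frob q f = 0 \<longleftrightarrow> f = 0"
  by (metis unfrob_frob push_zero)

text \<open>On monomials \<open>frob q\<close> is the \<open>q\<close>-th power, so a prime that
  contains the \<open>frob q\<close> image of a monomial contains the monomial. This links a point
  to its image under F.\<close>

lemma monomial_scale: "monomial (scale q u) = monomial u ^ q"
proof (induction q)
  case (Suc q)
  show ?case by (simp add: scale_Suc mult_single flip: Suc.IH)
qed simp

section \<open>Monomial subalgebras\<close>

definition monoid_alg :: "expo set \<Rightarrow> 'k::field alg set" where
  "monoid_alg S = {f. Poly_Mapping.keys f \<subseteq> S}"

definition submonoid :: "expo set \<Rightarrow> bool" where
  "submonoid S \<longleftrightarrow> 0 \<in> S \<and> (\<forall>u\<in>S. \<forall>v\<in>S. u + v \<in> S)"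

definition subring1 :: "'a::comm_ring_1 set \<Rightarrow> bool" where
  "subring1 R \<longleftrightarrow> 0 \<in> R \<and> 1 \<in> R \<and> (\<forall>x\<in>R. \<forall>y\<in>R. x + y \<in> R \<and> x * y \<in> R) \<and> (\<forall>x\<in>R. - x \<in> R)"

lemma subring1D:
  assumes "subring1 R"
  shows "0 \<in> R" "1 \<in> R" "x \<in> R \<Longrightarrow> y \<in> R \<Longrightarrow> x + y \<in> R" "x \<in> R \<Longrightarrow> y \<in> R \<Longrightarrow> x * y \<in> R"
    "x \<in> R \<Longrightarrow> - x \<in> R" "x \<in> R \<Longrightarrow> y \<in> R \<Longrightarrow> x - y \<in> R"
proof -
  show "x \<in> R \<Longrightarrow> y \<in> R \<Longrightarrow> x - y \<in> R"
    using assms unfolding subring1_def by (metis diff_conv_add_uminus)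
qed (use assms in \<open>auto simp: subring1_def\<close>)

lemma subring1_sum: "subring1 R \<Longrightarrow> (\<And>i. i \<in> I \<Longrightarrow> f i \<in> R) \<Longrightarrow> sum f I \<in> R"
  by (induction I rule: infinite_finite_induct) (auto simp: subring1D)

lemma subring1_prod: "subring1 R \<Longrightarrow> (\<And>i. i \<in> I \<Longrightarrow> f i \<in> R) \<Longrightarrow> prod f I \<in> R"
  by (induction I rule: infinite_finite_induct) (auto simp: subring1D)

lemma subring1_monoid_alg:
  assumes "submonoid S" shows "subring1 (monoid_alg S :: 'k::field alg set)"
  unfolding subring1_def
proof (intro conjI ballI)
  fix x y :: "'k alg" assume xy: "x \<in> monoid_alg S" "y \<in> monoid_alg S"
  then show "x + y \<in> monoid_alg S"
    using keys_add[of x y] by (auto simp: monoid_alg_def)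
  show "x * y \<in> monoid_alg S"
    using keys_mult_subset[of x S y S] xy assms by (auto simp: monoid_alg_def submonoid_def)
next
  fix x :: "'k alg" assume "x \<in> monoid_alg S"
  then show "- x \<in> monoid_alg S" by (auto simp: monoid_alg_def in_keys_iff)
qed (use assms in \<open>auto simp: monoid_alg_def submonoid_def\<close>)

lemma monoid_alg_mono: "S \<subseteq> T \<Longrightarrow> monoid_alg S \<subseteq> monoid_alg T"
  by (auto simp: monoid_alg_def)

lemma single_in_monoid_alg: "u \<in> S \<Longrightarrow> Poly_Mapping.single u c \<in> monoid_alg S"
  by (cases "c = 0") (auto simp: monoid_alg_def)

lemma submonoid_scale: "submonoid S \<Longrightarrow> u \<in> S \<Longrightarrow> scale q u \<in> S"
  by (induction q) (auto simp: scale_Suc submonoid_def)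

lemma frob_in_monoid_alg:
  assumes "submonoid S" "f \<in> monoid_alg S" shows "frob q f \<in> monoid_alg S"
  using assms keys_push[of "scale q" f] submonoid_scale[OF assms(1)]
  by (fastforce simp: monoid_alg_def)

lemma monomial_mult_mem:
  assumes "\<And>w. w \<in> Poly_Mapping.keys f \<Longrightarrow> v + w \<in> S"
  shows "monomial v * f \<in> monoid_alg S"
  using keys_mult_subset[of "monomial v" "{v}" f "Poly_Mapping.keys f"] assms
  by (auto simp: monoid_alg_def)

lemma lookup_monomial_mult: "lkp (monomial v * f) (v + w) = lkp f w"
proof -
  have "monomial v * f = (\<Sum>u\<in>Poly_Mapping.keys f. Poly_Mapping.single (v + u) (lkp f u))"
    by (subst poly_mapping_sum_single[of f]) (simp add: sum_distrib_left mult_single)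
  then show ?thesis
    by (simp add: lookup_sum lookup_single when_def in_keys_iff)
qed

section \<open>Prime ideals and local rings\<close>

lemma prime_idealD:
  assumes "prime_ideal A p"
  shows "p \<subseteq> A" "0 \<in> p" "1 \<notin> p" "x \<in> p \<Longrightarrow> y \<in> p \<Longrightarrow> x + y \<in> p"
    "a \<in> A \<Longrightarrow> x \<in> p \<Longrightarrow> a * x \<in> p" "a \<in> A \<Longrightarrow> x \<in> p \<Longrightarrow> x * a \<in> p"
    "a \<in> A \<Longrightarrow> b \<in> A \<Longrightarrow> a \<notin> p \<Longrightarrow> b \<notin> p \<Longrightarrow> a * b \<notin> p"
  using assms unfolding prime_ideal_def by (auto simp: mult.commute)

lemma prime_ideal_sum:
  "prime_ideal A p \<Longrightarrow> (\<And>i. i \<in> I \<Longrightarrow> f i \<in> p) \<Longrightarrow> sum f I \<in> p"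
  by (induction I rule: infinite_finite_induct) (auto simp: prime_idealD)

lemma prime_ideal_power:
  assumes "prime_ideal A p" "subring1 A" "x \<in> A" "x \<notin> p"
  shows "x ^ n \<in> A \<and> x ^ n \<notin> p"
  by (induction n) (use assms in \<open>auto simp: prime_idealD subring1D\<close>)

lemma prime_ideal_Int:
  assumes "prime_ideal B p" "A \<subseteq> B" "subring1 A"
  shows "prime_ideal A (p \<inter> A)"
  using assms unfolding prime_ideal_def subring1_def by (auto; blast)

text \<open>Krull's argument: an ideal that contains \<open>D\<close> and is maximal among those
  disjoint from the multiplicative set \<open>M\<close> is prime.\<close>

lemma prime_ideal_exists:
  fixes A D M :: "'a::comm_ring_1 set"
  assumes A: "subring1 A"
    and D: "D \<subseteq> A" "0 \<in> D" "\<And>x y. x \<in> D \<Longrightarrow> y \<in> D \<Longrightarrow> x + y \<in> D"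
      "\<And>a x. a \<in> A \<Longrightarrow> x \<in> D \<Longrightarrow> a * x \<in> D"
    and M: "M \<subseteq> A" "1 \<in> M" "\<And>x y. x \<in> M \<Longrightarrow> y \<in> M \<Longrightarrow> x * y \<in> M"
    and disj: "D \<inter> M = {}"
  obtains p where "prime_ideal A p" "D \<subseteq> p" "p \<inter> M = {}"
proof -
  define Ids where "Ids = {J. D \<subseteq> J \<and> J \<subseteq> A \<and> (\<forall>x\<in>J. \<forall>y\<in>J. x + y \<in> J)
    \<and> (\<forall>a\<in>A. \<forall>x\<in>J. a * x \<in> J) \<and> J \<inter> M = {}}"
  have "\<exists>U\<in>Ids. \<forall>X\<in>C. X \<subseteq> U" if C: "subset.chain Ids C" for C
  proof (cases "C = {}")
    case True
    have "D \<in> Ids" using D disj by (auto simp: Ids_def)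
    then show ?thesis using True by blast
  next
    case False
    have sub: "\<And>X. X \<in> C \<Longrightarrow> X \<in> Ids" and tot: "\<And>X Y. X \<in> C \<Longrightarrow> Y \<in> C \<Longrightarrow> X \<subseteq> Y \<or> Y \<subseteq> X"
      using C by (auto simp: subset_chain_def)
    have "x + y \<in> \<Union>C" if "x \<in> \<Union>C" "y \<in> \<Union>C" for x y
    proof -
      obtain X Y where XY: "X \<in> C" "x \<in> X" "Y \<in> C" "y \<in> Y" using \<open>x \<in> \<Union>C\<close> \<open>y \<in> \<Union>C\<close> by blast
      then have "\<exists>Z\<in>C. x \<in> Z \<and> y \<in> Z" using tot[of X Y] by blast
      then show ?thesis using sub unfolding Ids_def by blast
    qed
    moreover have "D \<subseteq> \<Union>C" using False sub by (fastforce simp: Ids_def)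
    moreover have "\<Union>C \<subseteq> A" "\<Union>C \<inter> M = {}" using sub unfolding Ids_def by blast+
    moreover have "\<forall>a\<in>A. \<forall>x\<in>\<Union>C. a * x \<in> \<Union>C" using sub by (fastforce simp: Ids_def)
    ultimately have "\<Union>C \<in> Ids" unfolding Ids_def by blast
    then show ?thesis by blast
  qed
  then obtain p where p: "p \<in> Ids" and max: "\<And>J. J \<in> Ids \<Longrightarrow> p \<subseteq> J \<Longrightarrow> J = p"
    using subset_Zorn[of Ids] by metis
  have pA: "p \<subseteq> A" and pD: "D \<subseteq> p" and padd: "\<And>x y. x \<in> p \<Longrightarrow> y \<in> p \<Longrightarrow> x + y \<in> p"
    and pmul: "\<And>a x. a \<in> A \<Longrightarrow> x \<in> p \<Longrightarrow> a * x \<in> p" and pM: "p \<inter> M = {}"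
    using p by (auto simp: Ids_def)
  \<comment> \<open>By maximality, the ideal generated by \<open>p\<close> and a further element
    \<open>x\<close> meets \<open>M\<close>.\<close>
  have ext: "\<exists>a\<in>A. \<exists>y\<in>p. a * x + y \<in> M" if x: "x \<in> A" "x \<notin> p" for x
  proof (rule ccontr)
    assume no: "\<not> ?thesis"
    define J where "J = {a * x + y | a y. a \<in> A \<and> y \<in> p}"
    have "p \<subseteq> J"
    proof
      fix y assume "y \<in> p"
      then have "y = 0 * x + y \<and> 0 \<in> A \<and> y \<in> p" using A by (simp add: subring1D)
      then show "y \<in> J" unfolding J_def by blast
    qed
    moreover have "u + v \<in> J" if "u \<in> J" "v \<in> J" for u v
    proof -
      obtain a y b z where "u = a * x + y" "v = b * x + z" "a \<in> A" "b \<in> A" "y \<in> p" "z \<in> p"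
        using \<open>u \<in> J\<close> \<open>v \<in> J\<close> unfolding J_def by blast
      then have "u + v = (a + b) * x + (y + z)" "a + b \<in> A" "y + z \<in> p"
        using A padd by (auto simp: algebra_simps subring1D)
      then show ?thesis unfolding J_def by blast
    qed
    moreover have "b * u \<in> J" if "b \<in> A" "u \<in> J" for b u
    proof -
      obtain a y where "u = a * x + y" "a \<in> A" "y \<in> p"
        using \<open>u \<in> J\<close> unfolding J_def by blast
      then have "b * u = (b * a) * x + b * y" "b * a \<in> A" "b * y \<in> p"
        using A pmul \<open>b \<in> A\<close> by (auto simp: algebra_simps subring1D)
      then show ?thesis unfolding J_def by blast
    qed
    moreover have "J \<subseteq> A" using pA x subring1D(3,4)[OF A] by (auto simp: J_def)
    moreover have "J \<inter> M = {}" using no by (auto simp: J_def)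
    ultimately have "J \<in> Ids" using pD unfolding Ids_def by blast
    then have "J = p" using max \<open>p \<subseteq> J\<close> by blast
    moreover have "x = 1 * x + 0 \<and> 1 \<in> A \<and> 0 \<in> p" using A pD D by (auto simp: subring1D)
    then have "x \<in> J" unfolding J_def by blast
    ultimately show False using x by blast
  qed
  have "prime_ideal A p"
    unfolding prime_ideal_def
  proof (intro conjI ballI impI)
    show "p \<subseteq> A" "0 \<in> p" "1 \<notin> p" using pA pD D pM M by auto
    fix a b assume ab: "a \<in> A" "b \<in> A" "a * b \<in> p"
    show "a \<in> p \<or> b \<in> p"
    proof (rule ccontr)
      assume "\<not> ?thesis"
      then obtain c y d z where c: "c \<in> A" "y \<in> p" "c * a + y \<in> M" "d \<in> A" "z \<in> p" "d * b + z \<in> M"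
        using ext ab by metis
      \<comment> \<open>This product lies in \<open>M\<close>, while every term of its expansion
        lies in \<open>p\<close>.\<close>
      have "(c * a + y) * (d * b + z)
          = (c * d) * (a * b) + ((c * a) * z + (d * b) * y + y * z)"
        by (simp add: algebra_simps)
      moreover have "\<dots> \<in> p"
        by (intro padd pmul subring1D(4)[OF A] c ab subsetD[OF pA])
      ultimately show False using M(3)[OF c(3,6)] pM by auto
    qed
  qed (use padd pmul in auto)
  then show ?thesis using that pD pM by blast
qed

section \<open>Local rings as subsets of the field of fractions\<close>

lemma local_ringI: "a \<in> A \<Longrightarrow> b \<in> A \<Longrightarrow> b \<notin> p \<Longrightarrow> Fract a b \<in> local_ring A p"
  unfolding local_ring_def by blast

lemma local_ringE:
  assumes "z \<in> local_ring A p"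
  obtains a b where "z = Fract a b" "a \<in> A" "b \<in> A" "b \<notin> p"
  using assms unfolding local_ring_def by blast

lemma local_ring_mult:
  assumes "subring1 A" "prime_ideal A p" "x \<in> local_ring A p" "y \<in> local_ring A p"
  shows "x * y \<in> local_ring A p"
  using assms(3,4)
  by (elim local_ringE)
    (simp, intro local_ringI subring1D(4)[OF assms(1)] prime_idealD(7)[OF assms(2)])

text \<open>Membership in the prime is recovered from the local ring alone. This transports it
  between charts that present the same point.\<close>

lemma inverse_in_local_ring_iff:
  assumes "subring1 A" "prime_ideal A p" "e \<in> A" "e \<noteq> 0"
  shows "Fract 1 e \<in> local_ring A p \<longleftrightarrow> e \<notin> p"
proof
  assume "Fract 1 e \<in> local_ring A p"
  then obtain a b where ab: "Fract 1 e = Fract a b" "a \<in> A" "b \<in> A" "b \<notin> p" by (elim local_ringE)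
  then have "b \<noteq> 0" using prime_idealD(2)[OF assms(2)] by auto
  then have "b = a * e" using ab assms(4) by (simp add: eq_fract)
  then show "e \<notin> p" using ab prime_idealD(5)[OF assms(2)] by blast
qed (use assms in \<open>auto intro: local_ringI simp: subring1D\<close>)

text \<open>The multipliers \<open>d\<close> and \<open>e\<close> of numerator and denominator move
  both into \<open>B\<close> at once, and the new denominator \<open>d * (e * b)\<close> stays
  outside the prime \<open>P'\<close>.\<close>

lemma local_ring_subset:
  assumes B: "subring1 B" "prime_ideal B P'"
    and *: "\<And>f. f \<in> A \<Longrightarrow> \<exists>d\<in>B. d \<notin> P' \<and> d * f \<in> B \<and> (f \<notin> P \<longrightarrow> d * f \<notin> P')"
  shows "local_ring A P \<subseteq> local_ring B P'"
proof
  fix z assume "z \<in> local_ring A P"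
  then obtain a b where z: "z = Fract a b" "a \<in> A" "b \<in> A" "b \<notin> P" by (elim local_ringE)
  obtain d e where d: "d \<in> B" "d \<notin> P'" "d * a \<in> B" and e: "e \<in> B" "e \<notin> P'" "e * b \<in> B" "e * b \<notin> P'"
    using *[OF z(2)] *[OF z(3)] z(4) by blast
  have nz: "d * (e * b) \<notin> P'" using d e prime_idealD(7)[OF B(2)] by blast
  then have "d * (e * b) \<noteq> 0" using prime_idealD(2)[OF B(2)] by metis
  then have "Fract (e * (d * a)) (d * (e * b)) = Fract a b"
    using mult_fract_cancel[of "d * e" a b] by (simp add: mult_ac)
  moreover have "e * (d * a) \<in> B" "d * (e * b) \<in> B" using d e subring1D(4)[OF B(1)] by blast+
  ultimately show "z \<in> local_ring B P'" using z(1) nz local_ringI by metis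
qed

section \<open>Schemes glued from monomial charts\<close>

text \<open>Non-units of the stalk are read off from the numerator. Zero is a separate case in
  \<open>max_ideal\<close> because \<open>inverse 0 = 0\<close> lies in the stalk.\<close>

lemma max_ideal_local_ring_iff:
  assumes A: "subring1 A" "prime_ideal A p" and ab: "a \<in> A" "b \<in> A" "b \<notin> p"
  shows "Fract a b \<in> max_ideal (local_ring A p) \<longleftrightarrow> a \<in> p"
proof -
  have b0: "b \<noteq> 0" using ab prime_idealD(2)[OF A(2)] by metis
  show ?thesis
  proof
    assume *: "Fract a b \<in> max_ideal (local_ring A p)"
    show "a \<in> p"
    proof (rule ccontr)
      assume "a \<notin> p"
      then have "inverse (Fract a b) \<in> local_ring A p" using ab by (simp add: local_ringI)
      then have "Fract a b = 0" using * by (auto simp: max_ideal_def)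
      then have "a = 0" using b0 by (simp add: Zero_fract_def eq_fract)
      then show False using \<open>a \<notin> p\<close> prime_idealD(2)[OF A(2)] by simp
    qed
  next
    assume a: "a \<in> p"
    have "a = 0" if inv: "Fract b a \<in> local_ring A p"
    proof (rule ccontr)
      assume a0: "a \<noteq> 0"
      obtain c d where cd: "Fract b a = Fract c d" "c \<in> A" "d \<in> A" "d \<notin> p"
        using local_ringE[OF inv] by blast
      then have "d \<noteq> 0" using prime_idealD(2)[OF A(2)] by metis
      then have "b * d = c * a" using cd a0 by (simp add: eq_fract)
      then show False using prime_idealD(7)[OF A(2) ab(2) cd(3) ab(3) cd(4)]
          prime_idealD(5)[OF A(2) cd(2) a] by simp
    qed
    then show "Fract a b \<in> max_ideal (local_ring A p)"
      using ab by (auto simp: max_ideal_def local_ringI fract_collapse)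
  qed
qed

lemma subring1_power: "subring1 R \<Longrightarrow> x \<in> R \<Longrightarrow> x ^ n \<in> R"
  by (induction n) (auto simp: subring1D)

lemma monomial_nonzero [simp]: "monomial u \<noteq> (0 :: 'k::field alg)"
  by (metis lookup_single_eq lookup_zero zero_neq_one)

lemma monomial_add: "monomial (u + v) = (monomial u * monomial v :: 'k::field alg)"
  by (simp add: mult_single)

lemma submonoid_shift:
  assumes "submonoid S" "v' \<in> S" "v \<in> S" "v + w \<in> S \<or> v' + w \<in> S"
  shows "v' + v + w \<in> S"
proof -
  have "v' + v + w = v' + (v + w)" "v' + v + w = v + (v' + w)" by (simp_all add: ac_simps)
  then show ?thesis using assms unfolding submonoid_def by metis
qed

lemma spec_eq_basic_open_1: "spec A = basic_open A 1"
  by (auto simp: spec_def basic_open_def prime_ideal_def)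

text \<open>The value is independent of the representing fraction: \<open>frob q\<close> is
  multiplicative, hence respects cross multiplication, and injective, hence keeps denominators
  nonzero.\<close>

lemma F_field_Fract:
  assumes "q > 0" "b \<noteq> 0"
  shows "F_field q (Fract a b) = Fract (frob q a) (frob q b)"
  unfolding F_field_def
proof (rule the_equality)
  fix w assume "\<exists>c d. d \<noteq> 0 \<and> Fract a b = Fract c d \<and> w = Fract (frob q c) (frob q d)"
  then obtain c d where cd: "d \<noteq> 0" "Fract a b = Fract c d" "w = Fract (frob q c) (frob q d)" by blast
  then have "frob q (a * d) = frob q (c * b)" using assms by (simp add: eq_fract)
  then show "w = Fract (frob q a) (frob q b)"
    using cd assms by (simp add: frob_mult eq_fract)
qed (use assms in blast)

text \<open>An abstraction of the toric charts. Every chart is spanned by a submonoid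
  \<open>S\<close> that generates the group \<open>M\<close>, and the torus is itself a chart; the
  cones enter only when the locale is interpreted.\<close>

locale monomial_charts =
  fixes \<A> :: "'k::field alg set set" and M :: "expo set" and q :: nat
  assumes q_pos: "q > 0"
    and M_monoid: "submonoid M" and M_uminus: "u \<in> M \<Longrightarrow> - u \<in> M"
    and M_chart: "monoid_alg M \<in> \<A>"
    and chart_exists: "A \<in> \<A> \<Longrightarrow>
      \<exists>S. A = monoid_alg S \<and> submonoid S \<and> S \<subseteq> M \<and> (\<forall>w\<in>M. \<exists>v\<in>S. v + w \<in> S)"
begin

definition A0 :: "'k alg set" where "A0 = monoid_alg M"

lemma A0_chart: "A0 \<in> \<A>"
  by (simp add: A0_def M_chart)

lemma chartE:
  assumes "A \<in> \<A>"
  obtains S where "A = monoid_alg S" "submonoid S" "S \<subseteq> M" "\<And>w. w \<in> M \<Longrightarrow> \<exists>v\<in>S. v + w \<in> S"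
  using chart_exists[OF assms] by blast

lemma chart_subring: "A \<in> \<A> \<Longrightarrow> subring1 A"
  by (metis chartE subring1_monoid_alg)

lemma chart_subset: "A \<in> \<A> \<Longrightarrow> A \<subseteq> A0"
  by (metis A0_def chartE monoid_alg_mono)

lemmas A0_subring = chart_subring[OF A0_chart]

lemma frob_in_chart: "A \<in> \<A> \<Longrightarrow> f \<in> A \<Longrightarrow> frob q f \<in> A"
  by (metis chartE frob_in_monoid_alg)

lemma monomial_in_A0: "v \<in> M \<Longrightarrow> monomial v \<in> A0"
  by (simp add: A0_def single_in_monoid_alg)

lemma monomial_notin_prime:
  assumes "prime_ideal A0 P" "v \<in> M" shows "monomial v \<notin> P"
proof
  assume "monomial v \<in> P"
  then have "monomial (- v) * monomial v \<in> P"
    using assms by (intro prime_idealD(5)[OF assms(1)]) (auto intro: M_uminus monomial_in_A0)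
  then show False using prime_idealD(3)[OF assms(1)] by (simp add: mult_single)
qed

text \<open>A single monomial clears the denominators of a whole Laurent polynomial; the shifts of
  the individual exponents are added up.\<close>

lemma common_shift:
  assumes S: "submonoid S" "\<And>w. w \<in> M \<Longrightarrow> \<exists>v\<in>S. v + w \<in> S" and "finite K" "K \<subseteq> M"
  shows "\<exists>v\<in>S. \<forall>w\<in>K. v + w \<in> S"
  using \<open>finite K\<close> \<open>K \<subseteq> M\<close>
proof (induction K)
  case (insert w K)
  then obtain v v' where v: "v \<in> S" "\<forall>w\<in>K. v + w \<in> S" "v' \<in> S" "v' + w \<in> S" using S(2)[of w] by auto
  have "v' + v + w' \<in> S" if "w' \<in> insert w K" for w'
    using that v submonoid_shift[OF S(1), of v' v w'] by auto
  moreover have "v' + v \<in> S" using v S(1) by (simp add: submonoid_def)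
  ultimately show ?case by blast
qed (use S in \<open>auto simp: submonoid_def\<close>)

lemma prime_ideal_chart:
  assumes "A \<in> \<A>" "prime_ideal A0 P" shows "prime_ideal A (P \<inter> A)"
  using assms prime_ideal_Int chart_subring chart_subset by blast

text \<open>The torus lies in every chart: monomials of \<open>A\<close> are units on it, and
  \<open>common_shift\<close> turns any Laurent polynomial into an element of \<open>A\<close> by
  multiplying with one of them.\<close>

lemma local_ring_chart:
  assumes "A \<in> \<A>" "prime_ideal A0 P"
  shows "local_ring A0 P = local_ring A (P \<inter> A)"
proof
  obtain S where S: "A = monoid_alg S" "submonoid S" "S \<subseteq> M" "\<And>w. w \<in> M \<Longrightarrow> \<exists>v\<in>S. v + w \<in> S"
    using chartE[OF assms(1)] by blast
  show "local_ring A0 P \<subseteq> local_ring A (P \<inter> A)"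
  proof (rule local_ring_subset[OF chart_subring[OF assms(1)] prime_ideal_chart[OF assms]])
    fix f assume f: "f \<in> A0"
    then obtain v where v: "v \<in> S" "\<forall>w\<in>Poly_Mapping.keys f. v + w \<in> S"
      using common_shift[OF S(2,4), of "Poly_Mapping.keys f"] by (auto simp: A0_def monoid_alg_def)
    have "monomial v \<in> A" "monomial v * f \<in> A" using v S by (auto intro: single_in_monoid_alg monomial_mult_mem)
    moreover have "monomial v \<notin> P" using monomial_notin_prime[OF assms(2)] v S by auto
    moreover have "monomial v * f \<notin> P" if "f \<notin> P"
      using prime_idealD(7)[OF assms(2)] that f calculation chart_subset[OF assms(1)] by blast
    ultimately show "\<exists>d\<in>A. d \<notin> P \<inter> A \<and> d * f \<in> A \<and> (f \<notin> P \<longrightarrow> d * f \<notin> P \<inter> A)" by blast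
  qed
  show "local_ring A (P \<inter> A) \<subseteq> local_ring A0 P"
    using chart_subset[OF assms(1)] by (auto simp: local_ring_def)
qed

section \<open>The map F on points\<close>

lemma prime_ideal_frob_vimage:
  assumes "A \<in> \<A>" "prime_ideal A p"
  shows "prime_ideal A {f \<in> A. frob q f \<in> p}"
  unfolding prime_ideal_def
proof (intro conjI ballI impI)
  note sub = chart_subring[OF assms(1)]
  show "0 \<in> {f \<in> A. frob q f \<in> p}" "1 \<notin> {f \<in> A. frob q f \<in> p}"
    using sub assms(2) by (auto simp: subring1D prime_idealD)
  fix a b
  show "a \<in> A \<Longrightarrow> b \<in> A \<Longrightarrow> a * b \<in> {f \<in> A. frob q f \<in> p} \<Longrightarrow>
      a \<in> {f \<in> A. frob q f \<in> p} \<or> b \<in> {f \<in> A. frob q f \<in> p}"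
    using prime_idealD(7)[OF assms(2)] frob_in_chart[OF assms(1)] by (auto simp: frob_mult)
  show "a \<in> {f \<in> A. frob q f \<in> p} \<Longrightarrow> b \<in> {f \<in> A. frob q f \<in> p} \<Longrightarrow> a + b \<in> {f \<in> A. frob q f \<in> p}"
    using sub assms(2) by (auto simp: subring1D prime_idealD push_add)
  show "a \<in> A \<Longrightarrow> b \<in> {f \<in> A. frob q f \<in> p} \<Longrightarrow> a * b \<in> {f \<in> A. frob q f \<in> p}"
    using sub assms(2) frob_in_chart[OF assms(1)] by (auto simp: subring1D prime_idealD frob_mult)
qed auto

text \<open>
  This makes \<open>F_pt\<close> well defined. A monomial of the first chart is regular at the common point, hence
  is a quotient of monomials of the second chart whose denominator is a unit there. As a monomial
  is a unit exactly where its \<open>q\<close>-th power is one, the denominator is also a unit at the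
  image of the point.
\<close>

lemma local_ring_frob_vimage_subset:
  assumes A: "A \<in> \<A>" "prime_ideal A p" and B: "B \<in> \<A>" "prime_ideal B p'"
    and eq: "local_ring A p = local_ring B p'"
  shows "local_ring A {f \<in> A. frob q f \<in> p} \<subseteq> local_ring B {f \<in> B. frob q f \<in> p'}"
proof (rule local_ring_subset[OF chart_subring[OF B(1)] prime_ideal_frob_vimage[OF B]])
  note subA = chart_subring[OF A(1)] and subB = chart_subring[OF B(1)]
  fix f assume f: "f \<in> A"
  obtain S where S: "A = monoid_alg S" "submonoid S" using chartE[OF A(1)] by blast
  obtain S' where S': "B = monoid_alg S'" "submonoid S'" using chartE[OF B(1)] by blast
  \<comment> \<open>Write x^w as \<open>a / g\<close> over the second chart. Some term of
    \<open>g\<close> lies outside \<open>p'\<close>, and its exponent is the denominator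
    sought.\<close>
  have one: "\<exists>v\<in>S'. monomial v \<notin> p' \<and> v + w \<in> S'" if w: "w \<in> S" for w
  proof -
    have "Fract (monomial w) 1 \<in> local_ring A p"
      using w S subA A(2) by (intro local_ringI) (auto simp: subring1D prime_idealD intro: single_in_monoid_alg)
    then obtain a g where ag: "Fract (monomial w) 1 = Fract a g" "a \<in> B" "g \<in> B" "g \<notin> p'"
      unfolding eq by (elim local_ringE)
    then have "g \<noteq> 0" using prime_idealD(2)[OF B(2)] by metis
    then have wg: "monomial w * g = a" using ag by (simp add: eq_fract)
    obtain v where v: "v \<in> Poly_Mapping.keys g" "Poly_Mapping.single v (lkp g v) \<notin> p'"
      using ag(4) prime_ideal_sum[OF B(2), of "Poly_Mapping.keys g"] poly_mapping_sum_single[of g] by metis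
    have "v \<in> S'" using ag(3) v S' by (auto simp: monoid_alg_def)
    moreover have "monomial v \<notin> p'"
    proof
      assume "monomial v \<in> p'"
      then have "Poly_Mapping.single 0 (lkp g v) * monomial v \<in> p'"
        using S' by (intro prime_idealD(5)[OF B(2)]) (auto intro!: single_in_monoid_alg simp: submonoid_def)
      then show False using v by (simp add: mult_single)
    qed
    moreover have "lkp a (w + v) \<noteq> 0" using v lookup_monomial_mult[of w g v] wg by (auto simp: in_keys_iff)
    then have "v + w \<in> S'" using ag(2) S' by (auto simp: monoid_alg_def in_keys_iff add.commute)
    ultimately show ?thesis by blast
  qed
  have "\<exists>v\<in>S'. monomial v \<notin> p' \<and> (\<forall>w\<in>K. v + w \<in> S')" if "finite K" "K \<subseteq> S" for K
    using that
  proof (induction K)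
    case empty
    then show ?case using S' prime_idealD(3)[OF B(2)] by (intro bexI[of _ 0]) (auto simp: submonoid_def)
  next
    case (insert w K)
    then obtain v v' where v: "v \<in> S'" "monomial v \<notin> p'" "\<forall>w\<in>K. v + w \<in> S'"
      and v': "v' \<in> S'" "monomial v' \<notin> p'" "v' + w \<in> S'" using one[of w] by auto
    have "v' + v + w' \<in> S'" if "w' \<in> insert w K" for w'
      using that v v' submonoid_shift[OF S'(2), of v' v w'] by auto
    moreover have "monomial v' * monomial v \<notin> p'"
      using v v' S' by (intro prime_idealD(7)[OF B(2)]) (auto intro: single_in_monoid_alg)
    ultimately show ?case using v v' S'(2)
      by (intro bexI[of _ "v' + v"]) (auto simp: submonoid_def mult_single)
  qed
  then obtain v where v: "v \<in> S'" "monomial v \<notin> p'" "\<forall>w\<in>Poly_Mapping.keys f. v + w \<in> S'"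
    using f S(1) unfolding monoid_alg_def by (metis finite_keys mem_Collect_eq)
  define d :: "'k alg" where "d = monomial v"
  have d: "d \<in> B" "d * f \<in> B" using v S' by (auto simp: d_def intro: single_in_monoid_alg monomial_mult_mem)
  have fd: "frob q d \<in> B" "frob q d \<notin> p'"
    using prime_ideal_power[OF B(2) subB d(1)] v(2) by (auto simp: d_def monomial_scale)
  \<comment> \<open>\<open>frob q f\<close> is a unit of the common stalk, and so is
    \<open>frob q d\<close>, the \<open>q\<close>-th power of a monomial outside \<open>p'\<close>.
    Hence their product is a unit as well.\<close>
  moreover have "frob q (d * f) \<notin> p'" if fp: "frob q f \<notin> p"
  proof -
    have nz: "frob q d \<noteq> 0" "frob q f \<noteq> 0"
      using fd fp prime_idealD(2)[OF A(2)] prime_idealD(2)[OF B(2)] by metis+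
    have "Fract 1 (frob q f) \<in> local_ring B p'"
      using inverse_in_local_ring_iff[OF subA A(2) frob_in_chart[OF A(1) f] nz(2)] fp eq by simp
    moreover have "Fract 1 (frob q d) \<in> local_ring B p'"
      using inverse_in_local_ring_iff[OF subB B(2) fd(1) nz(1)] fd by simp
    ultimately have "Fract 1 (frob q (d * f)) \<in> local_ring B p'"
      using local_ring_mult[OF subB B(2)] by (fastforce simp: frob_mult)
    then show ?thesis
      using inverse_in_local_ring_iff[OF subB B(2) frob_in_chart[OF B(1) d(2)]] nz q_pos by (simp add: frob_mult)
  qed
  ultimately show "\<exists>d\<in>B. d \<notin> {f \<in> B. frob q f \<in> p'} \<and> d * f \<in> B \<and>
      (f \<notin> {f \<in> A. frob q f \<in> p} \<longrightarrow> d * f \<notin> {f \<in> B. frob q f \<in> p'})"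
    using d f by blast
qed

lemma F_pt_local_ring:
  assumes "A \<in> \<A>" "prime_ideal A p"
  shows "F_pt q \<A> (local_ring A p) = local_ring A {f \<in> A. frob q f \<in> p}"
  unfolding F_pt_def
proof (rule the_equality)
  show "\<exists>B\<in>\<A>. \<exists>p'. prime_ideal B p' \<and> local_ring A p = local_ring B p' \<and>
      local_ring A {f \<in> A. frob q f \<in> p} = local_ring B {f \<in> B. frob q f \<in> p'}"
    using assms by blast
next
  fix y
  assume "\<exists>B\<in>\<A>. \<exists>p'. prime_ideal B p' \<and> local_ring A p = local_ring B p' \<and>
      y = local_ring B {f \<in> B. frob q f \<in> p'}"
  then obtain B p' where B: "B \<in> \<A>" "prime_ideal B p'" "local_ring A p = local_ring B p'"
    and y: "y = local_ring B {f \<in> B. frob q f \<in> p'}" by blast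
  show "y = local_ring A {f \<in> A. frob q f \<in> p}"
    unfolding y by (intro subset_antisym local_ring_frob_vimage_subset assms B(1,2) B(3) B(3)[symmetric])
qed

section \<open>The generic point, and sections as rational functions\<close>

lemma prime_ideal_0: "prime_ideal A0 {0}"
  using A0_subring by (auto simp: prime_ideal_def subring1D)

text \<open>The generic point of the scheme. Its stalk is the field of fractions of
  \<open>A0\<close>, and \<open>s gen\<close> is the rational function that a section
  \<open>s\<close> represents.\<close>

definition gen :: "'k pt" where "gen = local_ring A0 {0}"

lemma point_subset_gen:
  assumes "A \<in> \<A>" "prime_ideal A p" shows "local_ring A p \<subseteq> gen"
  using chart_subset[OF assms(1)] prime_idealD(2)[OF assms(2)] by (auto simp: gen_def local_ring_def)

text \<open>The inclusion of stalks says that \<open>x\<close> is a specialization of the torus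
  point \<open>P\<close>. If \<open>f\<close> cuts out a neighbourhood of \<open>x\<close>, then
  \<open>1 / f\<close> lies in the stalk of \<open>x\<close>, hence in the larger one.\<close>

lemma zariski_open_generization:
  assumes V: "zariski_open \<A> V" "x \<in> V" and P: "prime_ideal A0 P" "x \<subseteq> local_ring A0 P"
  shows "local_ring A0 P \<in> V"
proof -
  obtain A f where A: "A \<in> \<A>" "f \<in> A" "x \<in> basic_open A f" "basic_open A f \<subseteq> V"
    using V unfolding zariski_open_def by blast
  then obtain p where p: "x = local_ring A p" "prime_ideal A p" "f \<notin> p" unfolding basic_open_def by blast
  have f0: "f \<noteq> 0" using p prime_idealD(2) by metis
  have "Fract 1 f \<in> local_ring A p"
    using inverse_in_local_ring_iff[OF chart_subring[OF A(1)] p(2) A(2) f0] p by simp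
  then have "f \<notin> P"
    using inverse_in_local_ring_iff[OF A0_subring P(1) _ f0] P(2) p A chart_subset by blast
  then have "local_ring A0 P \<in> basic_open A f"
    using local_ring_chart[OF A(1) P(1)] prime_ideal_chart[OF A(1) P(1)] by (auto simp: basic_open_def)
  then show ?thesis using A by blast
qed

lemma zariski_open_gen:
  assumes "zariski_open \<A> V" "x \<in> V" shows "gen \<in> V"
proof -
  obtain A p where "A \<in> \<A>" "prime_ideal A p" "x = local_ring A p"
    using assms unfolding zariski_open_def spec_def by blast
  then show ?thesis
    using zariski_open_generization[OF assms prime_ideal_0] point_subset_gen by (simp add: gen_def)
qed

text \<open>Near \<open>x\<close> the section is one fraction, and the neighbourhood contains
  \<open>gen\<close>. So a section is one rational function, regular at every point of its
  domain.\<close>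

lemma section_at:
  assumes "s \<in> sections \<A> W" "x \<in> W" shows "s x = s gen" "s gen \<in> x"
proof -
  obtain V A a b where V: "zariski_open \<A> V" "x \<in> V" "V \<subseteq> W" "a \<in> A" "b \<in> A"
    and s: "\<forall>y\<in>V. y \<in> basic_open A b \<and> s y = Fract a b"
    using assms unfolding sections_def by blast
  then show "s x = s gen" using zariski_open_gen[OF V(1,2)] by simp
  moreover have "Fract a b \<in> x" using s V by (auto simp: basic_open_def intro: local_ringI)
  ultimately show "s gen \<in> x" using s V(2) by simp
qed

lemma basic_open_subset_spec: "basic_open A f \<subseteq> spec A"
  by (auto simp: basic_open_def spec_def)

lemma zariski_open_basic_open: "A \<in> \<A> \<Longrightarrow> f \<in> A \<Longrightarrow> zariski_open \<A> (basic_open A f)"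
  unfolding zariski_open_def using basic_open_subset_spec by blast

lemma basic_open_mult:
  assumes "f \<in> A0" "g \<in> A0" shows "basic_open A0 (f * g) \<subseteq> basic_open A0 f \<inter> basic_open A0 g"
  using assms by (auto simp: basic_open_def dest: prime_idealD(5,6))

lemma constant_section:
  assumes "a \<in> A0" "b \<in> A0" "e \<in> A0" "basic_open A0 e \<subseteq> basic_open A0 b"
  shows "res (basic_open A0 e) (\<lambda>_. Fract a b) \<in> sections \<A> (basic_open A0 e)"
  unfolding sections_def
proof (intro CollectI conjI allI impI ballI exI)
  show "zariski_open \<A> (basic_open A0 e)" by (rule zariski_open_basic_open[OF A0_chart assms(3)])
  show "\<exists>A\<in>\<A>. \<exists>a'\<in>A. \<exists>b'\<in>A. \<forall>y\<in>basic_open A0 e.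
      y \<in> basic_open A b' \<and> res (basic_open A0 e) (\<lambda>_. Fract a b) y = Fract a' b'"
    using assms by (intro bexI[OF _ A0_chart] bexI[OF _ assms(1)] bexI[OF _ assms(2)]) (auto simp: res_def)
qed (auto simp: res_def)

text \<open>One inclusion is the description of F on the torus chart. For the other, it must be
  shown that a point of any chart that F maps into the torus lies on the torus itself.\<close>

lemma F_preimage_basic_open:
  assumes f: "f \<in> A0"
  shows "F_preimage q \<A> (basic_open A0 f) = basic_open A0 (frob q f)"
proof (intro subset_antisym subsetI)
  fix y assume "y \<in> basic_open A0 (frob q f)"
  then obtain P where P: "y = local_ring A0 P" "prime_ideal A0 P" "frob q f \<notin> P"
    unfolding basic_open_def by blast
  then have "F_pt q \<A> y \<in> basic_open A0 f"
    using F_pt_local_ring[OF A0_chart P(2)] prime_ideal_frob_vimage[OF A0_chart P(2)]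
    by (auto simp: basic_open_def)
  then show "y \<in> F_preimage q \<A> (basic_open A0 f)"
    using P A0_chart by (auto simp: F_preimage_def spec_def)
next
  fix y assume "y \<in> F_preimage q \<A> (basic_open A0 f)"
  then obtain A p P0 where A: "A \<in> \<A>" and p: "prime_ideal A p" "y = local_ring A p"
    and P0: "prime_ideal A0 P0" "f \<notin> P0" "local_ring A {f \<in> A. frob q f \<in> p} = local_ring A0 P0"
    by (auto simp: F_preimage_def spec_def basic_open_def F_pt_local_ring)
  obtain S where S: "A = monoid_alg S" "submonoid S" "S \<subseteq> M" "\<And>w. w \<in> M \<Longrightarrow> \<exists>v\<in>S. v + w \<in> S"
    using chartE[OF A] by blast
  note subA = chart_subring[OF A] and pr = prime_ideal_frob_vimage[OF A p(1)]
  \<comment> \<open>If x^v vanished at the point, so would its \<open>q\<close>-th power, and x^v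
    would not be a unit at the image point, which lies on the torus.\<close>
  have mon: "monomial v \<notin> p" if v: "v \<in> S" for v
  proof
    have vA: "monomial v \<in> A" using v S by (auto intro: single_in_monoid_alg)
    assume "monomial v \<in> p"
    then have "monomial v ^ (q - 1) * monomial v \<in> p"
      by (intro prime_idealD(5)[OF p(1)] subring1_power[OF subA] vA)
    then have "frob q (monomial v) \<in> p" using power_minus_mult[OF q_pos, of "monomial v :: 'k alg"] by (simp add: monomial_scale)
    then have "Fract 1 (monomial v) \<notin> local_ring A0 P0"
      using inverse_in_local_ring_iff[OF subA pr vA] vA P0(3) by simp
    moreover have "Fract 1 (monomial v) \<in> local_ring A0 P0"
      using v S A0_subring by (intro local_ringI monomial_notin_prime[OF P0(1)] monomial_in_A0) (auto simp: subring1D)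
    ultimately show False by simp
  qed
  \<comment> \<open>The extension of \<open>p\<close> to \<open>A0\<close>, the localization of
    \<open>A\<close> at its monomials.\<close>
  define P where "P = {g \<in> A0. \<exists>v\<in>S. monomial v * g \<in> p}"
  \<comment> \<open>Monomials of \<open>A\<close> are outside \<open>p\<close>, so any
    \<open>v\<close> that moves \<open>g\<close> into \<open>A\<close> decides membership in
    \<open>P\<close>.\<close>
  have P_iff: "g \<in> P \<longleftrightarrow> monomial v * g \<in> p" if g: "g \<in> A0" "v \<in> S" "monomial v * g \<in> A" for g v
  proof
    assume "g \<in> P"
    then obtain w where w: "w \<in> S" "monomial w * g \<in> p" by (auto simp: P_def)
    have vA: "monomial v \<in> A" "monomial w \<in> A" using g w S by (auto intro: single_in_monoid_alg)
    have "monomial w * (monomial v * g) \<in> p"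
      using prime_idealD(5)[OF p(1) vA(1) w(2)] by (simp add: mult.left_commute)
    then show "monomial v * g \<in> p" using prime_idealD(7)[OF p(1) vA(2) g(3) mon[OF w(1)]] by blast
  qed (use g in \<open>auto simp: P_def\<close>)
  have shift: "\<exists>v\<in>S. monomial v \<in> A \<and> monomial v * g \<in> A" if g: "g \<in> A0" for g
  proof -
    obtain v where "v \<in> S" "\<forall>w\<in>Poly_Mapping.keys g. v + w \<in> S"
      using common_shift[OF S(2,4), of "Poly_Mapping.keys g"] g by (auto simp: A0_def monoid_alg_def)
    then show ?thesis using S by (auto intro: single_in_monoid_alg monomial_mult_mem)
  qed
  have primeP: "prime_ideal A0 P"
    unfolding prime_ideal_def
  proof (intro conjI ballI impI)
    have 0: "0 \<in> S" using S by (simp add: submonoid_def)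
    then show "0 \<in> P" using A0_subring prime_idealD(2)[OF p(1)] by (auto simp: P_def subring1D)
    show "1 \<notin> P" using mon by (auto simp: P_def)
    fix a b
    show "a + b \<in> P" if "a \<in> P" "b \<in> P"
    proof -
      have ab: "a \<in> A0" "b \<in> A0" using that by (auto simp: P_def)
      obtain v w where v: "v \<in> S" "monomial v \<in> A" "monomial v * a \<in> A"
        and w: "w \<in> S" "monomial w \<in> A" "monomial w * b \<in> A" using shift ab by metis
      have "monomial v * a \<in> p" "monomial w * b \<in> p" using P_iff ab v w that by auto
      then have "monomial w * (monomial v * a) + monomial v * (monomial w * b) \<in> p"
        using v w by (blast intro: prime_idealD(4)[OF p(1)] prime_idealD(5)[OF p(1)])
      then have "monomial (v + w) * (a + b) \<in> p"
        by (simp add: monomial_add algebra_simps)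
      then show ?thesis using ab v w S(2) A0_subring by (auto simp: P_def subring1D submonoid_def)
    qed
    show "a * b \<in> P" if ab: "a \<in> A0" "b \<in> P"
    proof -
      have bA: "b \<in> A0" using that by (auto simp: P_def)
      obtain v w where v: "v \<in> S" "monomial v \<in> A" "monomial v * a \<in> A"
        and w: "w \<in> S" "monomial w \<in> A" "monomial w * b \<in> A" using shift bA ab by metis
      have "(monomial v * a) * (monomial w * b) \<in> p"
        using P_iff[OF bA w(1,3)] ab prime_idealD(5)[OF p(1) v(3)] by blast
      then have "monomial (v + w) * (a * b) \<in> p"
        by (simp add: monomial_add mult_ac)
      then show ?thesis using that bA v w S(2) A0_subring by (auto simp: P_def subring1D submonoid_def)
    qed
    show "a \<in> P \<or> b \<in> P" if ab: "a \<in> A0" "b \<in> A0" "a * b \<in> P"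
    proof -
      obtain v w where v: "v \<in> S" "monomial v \<in> A" "monomial v * a \<in> A"
        and w: "w \<in> S" "monomial w \<in> A" "monomial w * b \<in> A" using shift ab by metis
      have eq: "monomial (v + w) * (a * b) = (monomial v * a) * (monomial w * b)"
        by (simp add: monomial_add mult_ac)
      have "(monomial v * a) * (monomial w * b) \<in> p"
        using P_iff[of "a * b" "v + w"] that v w S(2) A0_subring subring1D(4)[OF subA]
        unfolding eq by (auto simp: subring1D submonoid_def)
      then show ?thesis using prime_idealD(7)[OF p(1)] v w that P_iff by blast
    qed
  qed (auto simp: P_def)
  have "P \<inter> A = p"
  proof (intro subset_antisym subsetI)
    fix g assume g: "g \<in> p"
    then have "monomial 0 * g \<in> p" "g \<in> A" using prime_idealD(1)[OF p(1)] by auto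
    then show "g \<in> P \<inter> A" using chart_subset[OF A] S(2) unfolding P_def submonoid_def by blast
  next
    fix g assume "g \<in> P \<inter> A"
    then show "g \<in> p" using P_iff[of g 0] S(2) chart_subset[OF A] by (auto simp: submonoid_def)
  qed
  then have y: "y = local_ring A0 P" using local_ring_chart[OF A primeP] p by simp
  \<comment> \<open>\<open>f\<close> is a unit at the image point, so some multiple
    \<open>b = a * f\<close> has \<open>frob q b\<close> outside \<open>p\<close>; this excludes
    \<open>frob q f\<close> from \<open>P\<close>.\<close>
  have "frob q f \<notin> P"
  proof
    assume "frob q f \<in> P"
    then obtain v where v: "v \<in> S" "monomial v * frob q f \<in> p" by (auto simp: P_def)
    have f0: "f \<noteq> 0" using P0 prime_idealD(2)[OF P0(1)] by metis
    have "Fract 1 f \<in> local_ring A {f \<in> A. frob q f \<in> p}"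
      using inverse_in_local_ring_iff[OF A0_subring P0(1) f f0] P0 by simp
    then obtain a b where ab: "Fract 1 f = Fract a b" "a \<in> A" "b \<in> A" "frob q b \<notin> p"
      by (elim local_ringE) auto
    then have "b \<noteq> 0" using prime_idealD(2)[OF p(1)] by auto
    then have "b = a * f" using ab f0 by (simp add: eq_fract)
    then have "monomial v * frob q b = frob q a * (monomial v * frob q f)"
      by (simp add: frob_mult mult_ac)
    also have "\<dots> \<in> p" using v ab frob_in_chart[OF A] prime_idealD(5)[OF p(1)] by blast
    finally show False
      using prime_idealD(7)[OF p(1) _ frob_in_chart[OF A ab(3)] mon[OF v(1)] ab(4)] v S
      by (auto intro: single_in_monoid_alg)
  qed
  then show "y \<in> basic_open A0 (frob q f)" using y primeP by (auto simp: basic_open_def)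
qed

end

section \<open>Compatibility at generic points\<close>

lemma module_map_mult:
  "module_map q \<A> \<pi> \<Longrightarrow> zariski_open \<A> U \<Longrightarrow> f \<in> sections \<A> U \<Longrightarrow>
    s \<in> sections \<A> (F_preimage q \<A> U) \<Longrightarrow>
    \<pi> U (\<lambda>x. F_sharp q \<A> U f x * s x) = (\<lambda>x. f x * \<pi> U s x)"
  by (simp add: module_map_def F_direct_image_def)

context monomial_charts
begin

text \<open>\<open>x\<close> lies on the closure of the zero set of the ideal \<open>I\<close> of the torus.\<close>

definition on_closure :: "'k alg set \<Rightarrow> 'k pt \<Rightarrow> bool" where
  "on_closure I x \<longleftrightarrow> (\<exists>A\<in>\<A>. \<exists>Q. I \<inter> A \<subseteq> Q \<and> x = local_ring A Q)"

text \<open>A denominator outside \<open>Q\<close> is outside \<open>I\<close>, so the generic point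
  of \<open>I\<close> is a generization of \<open>x\<close>.\<close>

lemma on_closure_subset_generic:
  assumes "on_closure I x" shows "x \<subseteq> local_ring A0 I"
  using assms chart_subset unfolding on_closure_def local_ring_def by blast

text \<open>Vanishing at the generic point of \<open>I\<close> specializes to \<open>x\<close>: if
  \<open>a / b\<close> with \<open>a\<close> in \<open>I\<close> had an inverse \<open>c / d\<close>
  at \<open>x\<close>, then \<open>b * d = c * a\<close> would lie in \<open>I\<close> with neither
  \<open>b\<close> nor \<open>d\<close> in \<open>I\<close>.\<close>

lemma on_closure_max_ideal:
  assumes I: "prime_ideal A0 I" and x: "on_closure I x" and z: "z \<in> x" "z \<in> max_ideal (local_ring A0 I)"
  shows "z \<in> max_ideal x"
proof -
  obtain A Q where A: "A \<in> \<A>" and Q: "I \<inter> A \<subseteq> Q" "x = local_ring A Q"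
    using x unfolding on_closure_def by blast
  have AA0: "\<And>a. a \<in> A \<Longrightarrow> a \<in> A0" using chart_subset[OF A] by blast
  obtain a b where ab: "z = Fract a b" "a \<in> A" "b \<in> A" "b \<notin> Q"
    using z(1) unfolding Q(2) by (elim local_ringE)
  have bI: "b \<notin> I" using ab Q by blast
  have aI: "a \<in> I"
    using max_ideal_local_ring_iff[OF A0_subring I AA0[OF ab(2)] AA0[OF ab(3)] bI] z(2) ab(1) by simp
  have "a = 0" if inv: "Fract b a \<in> x"
  proof (rule ccontr)
    assume a0: "a \<noteq> 0"
    obtain c d where cd: "Fract b a = Fract c d" "c \<in> A" "d \<in> A" "d \<notin> Q"
      using local_ringE[OF inv[unfolded Q(2)]] by blast
    have dI: "d \<notin> I" using cd Q by blast
    then have "d \<noteq> 0" using prime_idealD(2)[OF I] by metis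
    then have "b * d = c * a" using cd a0 by (simp add: eq_fract)
    then show False
      using prime_idealD(5)[OF I AA0[OF cd(2)] aI] prime_idealD(7)[OF I AA0[OF ab(3)] AA0[OF cd(3)] bI dI]
      by simp
  qed
  then show ?thesis using z(1) ab(1) by (auto simp: max_ideal_def fract_collapse)
qed

lemma Fract_1_in_generic_iff:
  assumes "prime_ideal A0 I" "a \<in> A0"
  shows "Fract a 1 \<in> max_ideal (local_ring A0 I) \<longleftrightarrow> a \<in> I"
  using assms A0_subring by (intro max_ideal_local_ring_iff) (auto simp: subring1D prime_idealD)

section \<open>Constant sections over open subsets of the torus\<close>

abbreviation torus_pts :: "'k pt set" where "torus_pts \<equiv> spec A0"
abbreviation torus_sec :: "'k alg \<Rightarrow> 'k pt \<Rightarrow> 'k alg fract" where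
  "torus_sec f \<equiv> res torus_pts (\<lambda>_. Fract f 1)"

lemma zariski_open_torus: "zariski_open \<A> torus_pts"
  using zariski_open_basic_open[OF A0_chart, of 1] A0_subring by (simp add: spec_eq_basic_open_1 subring1D)

lemma F_preimage_torus: "F_preimage q \<A> torus_pts = torus_pts"
  using F_preimage_basic_open[of 1] A0_subring by (simp add: spec_eq_basic_open_1 subring1D)

lemma constant_section1:
  assumes "a \<in> A0" "e \<in> A0"
  shows "res (basic_open A0 e) (\<lambda>_. Fract a 1) \<in> sections \<A> (basic_open A0 e)"
  using assms A0_subring basic_open_subset_spec[of A0 e] unfolding spec_eq_basic_open_1
  by (intro constant_section) (auto simp: subring1D)

lemma torus_section_mem: "a \<in> A0 \<Longrightarrow> torus_sec a \<in> sections \<A> torus_pts"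
  using constant_section1[of a 1] A0_subring by (simp add: spec_eq_basic_open_1 subring1D)

text \<open>Linearity over the structure sheaf for a constant section \<open>g\<close>: its image
  under \<open>F_sharp\<close> is the constant \<open>frob q g\<close>, so \<open>g\<close> can be
  pulled out of the module map.\<close>

lemma module_map_basic_open:
  assumes \<pi>: "module_map q \<A> \<pi>" and e: "e \<in> A0" and g: "g \<in> A0"
    and s: "res (basic_open A0 (frob q e)) (\<lambda>_. z) \<in> sections \<A> (basic_open A0 (frob q e))"
    and x: "x \<in> basic_open A0 e"
  shows "\<pi> (basic_open A0 e) (res (basic_open A0 (frob q e)) (\<lambda>_. Fract (frob q g) 1 * z)) x
       = Fract g 1 * \<pi> (basic_open A0 e) (res (basic_open A0 (frob q e)) (\<lambda>_. z)) x"
proof -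
  let ?V = "basic_open A0 e" and ?W = "basic_open A0 (frob q e)"
  let ?g = "res ?V (\<lambda>_. Fract g 1)" and ?s = "res ?W (\<lambda>_. z)"
  have pre: "F_preimage q \<A> ?V = ?W" by (rule F_preimage_basic_open[OF e])
  have "F_pt q \<A> y \<in> ?V" if "y \<in> ?W" for y using that unfolding pre[symmetric] by (simp add: F_preimage_def)
  then have "(\<lambda>y. F_sharp q \<A> ?V ?g y * ?s y) = res ?W (\<lambda>_. Fract (frob q g) 1 * z)"
    using q_pos by (auto simp: F_sharp_def pre res_def F_field_Fract)
  moreover have "zariski_open \<A> ?V" by (rule zariski_open_basic_open[OF A0_chart e])
  then have "\<pi> ?V (\<lambda>y. F_sharp q \<A> ?V ?g y * ?s y) = (\<lambda>y. ?g y * \<pi> ?V ?s y)"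
    using module_map_mult[OF \<pi> _ constant_section1[OF g e]] s pre by simp
  ultimately have "\<pi> ?V (res ?W (\<lambda>_. Fract (frob q g) 1 * z)) x = ?g x * \<pi> ?V ?s x" by simp
  moreover have "?g x = Fract g 1" using x by (simp add: res_def)
  ultimately show ?thesis by simp
qed

text \<open>
  A prime that contains all denominators of \<open>s\<close> but no \<open>frob q g\<close> with \<open>g \<notin> I\<close> would be mapped
  by \<open>F\<close> to a generization of the generic point of \<open>I\<close>, hence into \<open>U\<close>, where \<open>s\<close> is regular.
\<close>

lemma section_clear_denominators:
  assumes U: "zariski_open \<A> U" and I: "prime_ideal A0 I" and \<eta>: "local_ring A0 I \<in> U"
    and s: "s \<in> sections \<A> (F_preimage q \<A> U)"
  obtains g h where "g \<in> A0" "g \<notin> I" "h \<in> A0" "s gen = Fract h (frob q g)"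
proof -
  \<comment> \<open>\<open>D\<close> is the ideal of denominators of the rational function
    \<open>s gen\<close>, and \<open>N\<close> the multiplicative set of admissible
    denominators.\<close>
  define D where "D = {b \<in> A0. \<exists>a\<in>A0. Fract b 1 * s gen = Fract a 1}"
  define N where "N = frob q ` (A0 - I)"
  note sub = subring1D[OF A0_subring]
  have "D \<inter> N \<noteq> {}"
  proof
    assume disj: "D \<inter> N = {}"
    have D0: "D \<subseteq> A0" by (auto simp: D_def)
    have D1: "0 \<in> D" using sub(1) by (auto simp: D_def fract_collapse intro!: bexI[of _ 0])
    have D2: "x + y \<in> D" if xy: "x \<in> D" "y \<in> D" for x y
    proof -
      obtain a b where ab: "x \<in> A0" "y \<in> A0" "a \<in> A0" "b \<in> A0"
        "Fract x 1 * s gen = Fract a 1" "Fract y 1 * s gen = Fract b 1"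
        using xy unfolding D_def by blast
      have "Fract (x + y) 1 = Fract x 1 + Fract y 1" by simp
      then have "Fract (x + y) 1 * s gen = Fract a 1 + Fract b 1" using ab by (simp only: distrib_right)
      then have "Fract (x + y) 1 * s gen = Fract (a + b) 1" by simp
      then show ?thesis using ab sub(3) unfolding D_def by blast
    qed
    have D3: "c * x \<in> D" if cx: "c \<in> A0" "x \<in> D" for c x
    proof -
      obtain a where a: "x \<in> A0" "a \<in> A0" "Fract x 1 * s gen = Fract a 1"
        using cx unfolding D_def by blast
      have "Fract (c * x) 1 = Fract c 1 * Fract x 1" by simp
      then have "Fract (c * x) 1 * s gen = Fract c 1 * Fract a 1" using a by (simp only: mult.assoc)
      then have "Fract (c * x) 1 * s gen = Fract (c * a) 1" by simp
      then show ?thesis using a cx sub(4) unfolding D_def by blast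
    qed
    have N0: "N \<subseteq> A0" using frob_in_chart[OF A0_chart] by (auto simp: N_def)
    have N1: "1 \<in> N" using sub(2) prime_idealD(3)[OF I] by (auto simp: N_def image_iff intro!: bexI[of _ 1])
    have N2: "x * y \<in> N" if xy: "x \<in> N" "y \<in> N" for x y
    proof -
      obtain a b where ab: "x = frob q a" "y = frob q b" "a \<in> A0" "a \<notin> I" "b \<in> A0" "b \<notin> I"
        using xy unfolding N_def by blast
      then have "x * y = frob q (a * b)" "a * b \<in> A0" "a * b \<notin> I"
        using sub(4) prime_idealD(7)[OF I] by (auto simp: frob_mult)
      then show ?thesis unfolding N_def by blast
    qed
    obtain P where P: "prime_ideal A0 P" "D \<subseteq> P" "P \<inter> N = {}"
      using prime_ideal_exists[OF A0_subring D0 D1 D2 D3 N0 N1 N2 disj] by blast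
    let ?y = "local_ring A0 P"
    \<comment> \<open>Avoiding \<open>N\<close> means that F maps the point \<open>P\<close> to a
      prime inside \<open>I\<close>, that is, to a generization of the generic point of
      \<open>I\<close>.\<close>
    have PI: "{f \<in> A0. frob q f \<in> P} \<subseteq> I" using P by (auto simp: N_def)
    have "F_pt q \<A> ?y \<in> U"
    proof -
      have pr: "prime_ideal A0 {f \<in> A0. frob q f \<in> P}" by (rule prime_ideal_frob_vimage[OF A0_chart P(1)])
      have "local_ring A0 I \<subseteq> local_ring A0 {f \<in> A0. frob q f \<in> P}"
        using PI unfolding local_ring_def by blast
      then show ?thesis
        using zariski_open_generization[OF U \<eta> pr] F_pt_local_ring[OF A0_chart P(1)] by simp
    qed
    then have "?y \<in> F_preimage q \<A> U" using A0_chart P by (auto simp: F_preimage_def spec_def)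
    then have "s gen \<in> ?y" using section_at(2)[OF s] by simp
    then obtain a b where ab: "s gen = Fract a b" "a \<in> A0" "b \<in> A0" "b \<notin> P" by (elim local_ringE)
    then have "b \<noteq> 0" using prime_idealD(2)[OF P(1)] by metis
    then have "Fract b 1 * s gen = Fract a 1" using ab by (simp add: eq_fract)
    then have "b \<in> D" using ab by (auto simp: D_def)
    then show False using P ab by blast
  qed
  then obtain g h where gh: "g \<in> A0" "g \<notin> I" "h \<in> A0" "Fract (frob q g) 1 * s gen = Fract h 1"
    by (auto simp: D_def N_def)
  then have "frob q g \<noteq> 0" using q_pos prime_idealD(2)[OF I] by auto
  moreover obtain a b where "s gen = Fract a b" "b \<noteq> 0" by (cases "s gen") 
  ultimately have "s gen = Fract h (frob q g)" using gh(4) by (simp add: eq_fract mult_ac)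
  then show ?thesis using that gh by blast
qed

text \<open>\<open>P\<close> is the module map on the torus and \<open>I i\<close> the ideal of the
  component \<open>Z i\<close> there. Vanishing is checked at the generic point of
  \<open>I i\<close> and carried to the other points of \<open>Z i\<close> by
  \<open>on_closure_max_ideal\<close>.\<close>

lemma compatible_closures_if:
  assumes \<pi>: "module_map q \<A> \<pi>"
    and P: "\<And>f. f \<in> A0 \<Longrightarrow> P f \<in> A0 \<and> \<pi> torus_pts (torus_sec f) = torus_sec (P f)"
    and I: "\<And>i. i \<in> J \<Longrightarrow> prime_ideal A0 (I i)"
    and frob_I: "\<And>i f. i \<in> J \<Longrightarrow> f \<in> A0 \<Longrightarrow> frob q f \<in> I i \<longleftrightarrow> f \<in> I i"
    and Z: "\<And>i x. i \<in> J \<Longrightarrow> x \<in> Z i \<Longrightarrow> on_closure (I i) x"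
    and \<eta>: "\<And>i. i \<in> J \<Longrightarrow> local_ring A0 (I i) \<in> Z i"
    and PI: "\<And>i f. i \<in> J \<Longrightarrow> f \<in> I i \<Longrightarrow> P f \<in> I i"
  shows "compatible q \<A> \<pi> (\<Union>i\<in>J. Z i)"
  unfolding compatible_def
proof (intro allI impI ballI)
  fix U s assume U: "zariski_open \<A> U" and s: "s \<in> ideal_sheaf \<A> (\<Union>i\<in>J. Z i) (F_preimage q \<A> U)"
  let ?W = "F_preimage q \<A> U"
  have s_sec: "s \<in> sections \<A> ?W" and s_max: "\<And>i x. i \<in> J \<Longrightarrow> x \<in> ?W \<Longrightarrow> x \<in> Z i \<Longrightarrow> s x \<in> max_ideal x"
    using s by (auto simp: ideal_sheaf_def)
  let ?t = "\<pi> U s"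
  have t_sec: "?t \<in> sections \<A> U"
    using \<pi> U s_sec unfolding module_map_def F_direct_image_def by blast
  have "?t x \<in> max_ideal x" if x: "x \<in> U" "i \<in> J" "x \<in> Z i" for x i
  proof -
    let ?\<eta> = "local_ring A0 (I i)"
    note Ii = I[OF x(2)]
    have \<eta>U: "?\<eta> \<in> U"
      using zariski_open_generization[OF U x(1) Ii] on_closure_subset_generic[OF Z[OF x(2,3)]] by blast
    \<comment> \<open>The ideal is its own preimage under \<open>frob q\<close>, so F fixes its
      generic point.\<close>
    have "{f \<in> A0. frob q f \<in> I i} = I i" using frob_I[OF x(2)] prime_idealD(1)[OF Ii] by blast
    then have "F_pt q \<A> ?\<eta> = ?\<eta>" using F_pt_local_ring[OF A0_chart Ii] by simp
    then have \<eta>W: "?\<eta> \<in> ?W" using \<eta>U A0_chart Ii by (auto simp: F_preimage_def spec_def)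
    obtain g h where g: "g \<in> A0" "g \<notin> I i" and h: "h \<in> A0" and z: "s gen = Fract h (frob q g)"
      using section_clear_denominators[OF U Ii \<eta>U s_sec] by blast
    have fg: "frob q g \<in> A0" "frob q g \<notin> I i" using g frob_I[OF x(2)] frob_in_chart[OF A0_chart] by auto
    have "s gen \<in> max_ideal ?\<eta>"
      using s_max[OF x(2) \<eta>W \<eta>[OF x(2)]] section_at(1)[OF s_sec \<eta>W] by simp
    then have "h \<in> I i" using max_ideal_local_ring_iff[OF A0_subring Ii h fg] z by simp
    then have Ph: "P h \<in> I i" using PI x by blast
    obtain A f where A: "A \<in> \<A>" "f \<in> A" "?\<eta> \<in> basic_open A f" "basic_open A f \<subseteq> U"
      using U \<eta>U unfolding zariski_open_def by blast
    have fA0: "f \<in> A0" using A chart_subset by blast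
    obtain p where p: "prime_ideal A p" "?\<eta> = local_ring A p" "f \<notin> p" using A(3) by (auto simp: basic_open_def)
    have f0: "f \<noteq> 0" using p prime_idealD(2)[OF p(1)] by metis
    have fI: "f \<notin> I i"
      using inverse_in_local_ring_iff[OF chart_subring[OF A(1)] p(1) A(2) f0]
        inverse_in_local_ring_iff[OF A0_subring Ii fA0 f0] p by simp
    \<comment> \<open>Inverting \<open>f\<close> keeps the open set inside \<open>U\<close>;
      inverting \<open>g\<close> makes \<open>h / frob q g\<close> regular on its preimage.\<close>
    define e where "e = f * g"
    have e: "e \<in> A0" "e \<notin> I i"
      using fA0 fI g prime_idealD(7)[OF Ii] subring1D(4)[OF A0_subring] by (auto simp: e_def)
    let ?V = "basic_open A0 e"
    let ?VW = "basic_open A0 (frob q e)"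
    have Vf: "?V \<subseteq> basic_open A f"
    proof
      fix y assume "y \<in> ?V"
      then obtain Q where "prime_ideal A0 Q" "y = local_ring A0 Q" "f \<notin> Q"
        using basic_open_mult[OF fA0 g(1)] by (auto simp: e_def basic_open_def)
      then show "y \<in> basic_open A f"
        using local_ring_chart[OF A(1)] prime_ideal_chart[OF A(1)] by (auto simp: basic_open_def)
    qed
    have VU: "?V \<subseteq> U" and V: "zariski_open \<A> ?V" and \<eta>V: "?\<eta> \<in> ?V"
      using Vf A zariski_open_basic_open[OF A0_chart e(1)] Ii e by (auto simp: basic_open_def)
    have pre: "F_preimage q \<A> ?V = ?VW" by (rule F_preimage_basic_open[OF e(1)])
    have VW: "?VW \<subseteq> ?W" unfolding pre[symmetric] using VU by (auto simp: F_preimage_def)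
    have rs: "res ?VW s = res ?VW (\<lambda>_. s gen)"
      using section_at(1)[OF s_sec] VW by (auto simp: res_def fun_eq_iff)
    have fe: "frob q e \<in> A0" using frob_in_chart[OF A0_chart e(1)] .
    have "?VW \<subseteq> basic_open A0 (frob q g)"
      using basic_open_mult[OF frob_in_chart[OF A0_chart fA0] fg(1)] by (simp add: e_def frob_mult)
    then have rs_sec: "res ?VW (\<lambda>_. s gen) \<in> sections \<A> ?VW"
      unfolding z using constant_section[OF h fg(1) fe] by blast
    have "frob q g \<noteq> 0" using fg prime_idealD(2)[OF Ii] by metis
    then have gz: "Fract (frob q g) 1 * s gen = Fract h 1" by (simp add: z eq_fract)
    have restr: "\<pi> ?V (res ?VW s) = res ?V ?t"
      using \<pi> U V VU s_sec unfolding module_map_def F_direct_image_def pre[symmetric] by blast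
    have VT: "?V \<subseteq> torus_pts" "?VW \<subseteq> torus_pts" by (rule basic_open_subset_spec)+
    have "res ?VW (torus_sec h) = res ?VW (\<lambda>_. Fract h 1)" using VT by (auto simp: res_def fun_eq_iff)
    \<comment> \<open>The image of \<open>h\<close> is computed twice: restricted from the torus it
      is \<open>P h\<close>, and by linearity it is \<open>g\<close> times the image of
      \<open>s\<close>.\<close>
    moreover have "\<pi> ?V (res ?VW (torus_sec h)) = res ?V (\<pi> torus_pts (torus_sec h))"
    proof -
      have "torus_sec h \<in> F_direct_image q \<A> torus_pts"
        by (simp add: F_direct_image_def F_preimage_torus torus_section_mem[OF h])
      then show ?thesis
        using \<pi> zariski_open_torus V VT(1) unfolding module_map_def pre[symmetric] by blast
    qed
    ultimately have "\<pi> ?V (res ?VW (\<lambda>_. Fract h 1)) ?\<eta> = Fract (P h) 1"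
      using P[OF h] \<eta>V VT by (auto simp: res_def)
    moreover have "\<pi> ?V (res ?VW (\<lambda>_. Fract h 1)) ?\<eta> = Fract g 1 * ?t ?\<eta>"
      using module_map_basic_open[OF \<pi> e(1) g(1) rs_sec \<eta>V] restr \<eta>V
      unfolding gz rs[symmetric] by (simp add: res_def)
    ultimately have gt: "Fract g 1 * ?t ?\<eta> = Fract (P h) 1" by simp
    have "g \<noteq> 0" using g prime_idealD(2)[OF Ii] by metis
    have "Fract 1 g * (Fract g 1 * ?t ?\<eta>) = ?t ?\<eta>"
      using \<open>g \<noteq> 0\<close> by (simp add: mult.assoc[symmetric] eq_fract One_fract_def)
    then have "?t ?\<eta> = Fract (P h) g" unfolding gt by simp
    then have "?t ?\<eta> \<in> max_ideal ?\<eta>"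
      using max_ideal_local_ring_iff[OF A0_subring Ii _ g] P[OF h] Ph by simp
    moreover have "?t ?\<eta> = ?t x" using section_at(1)[OF t_sec] \<eta>U x(1) by simp
    moreover have "?t x \<in> x" using section_at[OF t_sec x(1)] by simp
    ultimately show ?thesis using on_closure_max_ideal[OF Ii Z[OF x(2,3)]] by simp
  qed
  then show "?t \<in> ideal_sheaf \<A> (\<Union>i\<in>J. Z i) U" using t_sec by (auto simp: ideal_sheaf_def)
qed

text \<open>The auxiliary \<open>g\<close> isolates the component \<open>i\<close>: the factor
  \<open>frob q g\<close> makes \<open>f\<close> vanish on the other components, and
  \<open>g\<close> is cancelled again modulo the prime \<open>I i\<close>.\<close>

lemma compatible_closures_only_if:
  assumes \<pi>: "module_map q \<A> \<pi>"
    and P: "\<And>f. f \<in> A0 \<Longrightarrow> P f \<in> A0 \<and> \<pi> torus_pts (torus_sec f) = torus_sec (P f)"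
    and I: "\<And>i. i \<in> J \<Longrightarrow> prime_ideal A0 (I i)"
    and frob_I: "\<And>i f. i \<in> J \<Longrightarrow> f \<in> A0 \<Longrightarrow> frob q f \<in> I i \<longleftrightarrow> f \<in> I i"
    and Z: "\<And>i x. i \<in> J \<Longrightarrow> x \<in> Z i \<Longrightarrow> on_closure (I i) x"
    and \<eta>: "\<And>i. i \<in> J \<Longrightarrow> local_ring A0 (I i) \<in> Z i"
    and comp: "compatible q \<A> \<pi> (\<Union>i\<in>J. Z i)"
    and i: "i \<in> J" and g: "g \<in> A0" "g \<notin> I i" "\<And>j. j \<in> J \<Longrightarrow> j \<noteq> i \<Longrightarrow> g \<in> I j"
    and f: "f \<in> I i"
  shows "P f \<in> I i"
proof -
  let ?\<eta> = "local_ring A0 (I i)" and ?a = "frob q g * f"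
  note Ii = I[OF i]
  have fA: "f \<in> A0" using f prime_idealD(1)[OF Ii] by blast
  have fg: "frob q g \<in> A0" using g frob_in_chart[OF A0_chart] by blast
  have aA: "?a \<in> A0" using fA fg subring1D(4)[OF A0_subring] by blast
  have aI: "?a \<in> I j" if j: "j \<in> J" for j
  proof (cases "j = i")
    case True
    then show ?thesis using prime_idealD(5)[OF Ii fg f] by simp
  next
    case False
    then have "frob q g \<in> I j" using g j frob_I[OF j] by blast
    then show ?thesis using prime_idealD(6)[OF I[OF j] fA] by simp
  qed
  have a_sec: "torus_sec ?a \<in> sections \<A> torus_pts" by (rule torus_section_mem[OF aA])
  have "torus_sec ?a x \<in> max_ideal x" if x: "x \<in> torus_pts" "j \<in> J" "x \<in> Z j" for x j
  proof -
    have "Fract ?a 1 \<in> x"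
      using x aA A0_subring by (auto simp: spec_def intro!: local_ringI simp: subring1D prime_idealD)
    moreover have "Fract ?a 1 \<in> max_ideal (local_ring A0 (I j))"
      using Fract_1_in_generic_iff[OF I[OF x(2)] aA] aI[OF x(2)] by simp
    ultimately show ?thesis using on_closure_max_ideal[OF I[OF x(2)] Z[OF x(2,3)]] x by (simp add: res_def)
  qed
  then have "torus_sec ?a \<in> ideal_sheaf \<A> (\<Union>i\<in>J. Z i) (F_preimage q \<A> torus_pts)"
    using a_sec by (auto simp: ideal_sheaf_def F_preimage_torus)
  then have "\<pi> torus_pts (torus_sec ?a) \<in> ideal_sheaf \<A> (\<Union>i\<in>J. Z i) torus_pts"
    using comp zariski_open_torus unfolding compatible_def by blast
  moreover have \<eta>T: "?\<eta> \<in> torus_pts" using Ii by (auto simp: spec_def)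
  ultimately have m: "\<pi> torus_pts (torus_sec ?a) ?\<eta> \<in> max_ideal ?\<eta>"
    using \<eta>[OF i] i by (auto simp: ideal_sheaf_def)
  have "\<pi> torus_pts (torus_sec ?a) ?\<eta> = Fract g 1 * \<pi> torus_pts (torus_sec f) ?\<eta>"
    using module_map_basic_open[OF \<pi> _ g(1), of 1 "Fract f 1" ?\<eta>] A0_subring torus_section_mem[OF fA] \<eta>T
    by (simp add: spec_eq_basic_open_1 subring1D)
  also have "\<dots> = Fract (g * P f) 1" using P[OF fA] \<eta>T by (simp add: res_def)
  finally have "g * P f \<in> I i"
    using m Fract_1_in_generic_iff[OF Ii] P[OF fA] subring1D(4)[OF A0_subring g(1)] by simp
  then show ?thesis using prime_idealD(7)[OF Ii g(1) _ g(2)] P[OF fA] by blast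
qed

end

section \<open>Charts of a complete fan\<close>

lemma M_pow_iff: "u \<in> M_pow r m \<longleftrightarrow> (\<forall>j l. lkp (lkp u j) l \<in> \<int>) \<and>
    (\<forall>j l. \<not> (j \<in> {1..m} \<and> l < r) \<longrightarrow> lkp (lkp u j) l = 0)"
  unfolding M_pow_def by blast

lemma M_pow_closed:
  shows "0 \<in> M_pow r m" "u \<in> M_pow r m \<Longrightarrow> v \<in> M_pow r m \<Longrightarrow> u + v \<in> M_pow r m"
    "u \<in> M_pow r m \<Longrightarrow> - u \<in> M_pow r m" "u \<in> M_pow r m \<Longrightarrow> v \<in> M_pow r m \<Longrightarrow> u - v \<in> M_pow r m"
  by (auto simp: M_pow_iff lookup_add lookup_minus)

lemma coord_ring_eq: "coord_ring r m C = monoid_alg (dual_monoid r m C)"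
  by (simp add: coord_ring_def monoid_alg_def)

lemma pairing_add: "pairing r (\<lambda>l. u l + v l) x = pairing r u x + pairing r v x"
  by (simp add: pairing_def distrib_right sum.distrib)

lemma pairing_zero [simp]: "pairing r (\<lambda>l. 0) x = 0" "pairing r u (\<lambda>l. 0) = 0"
  by (simp_all add: pairing_def)

lemma pairing_sum: "pairing r u (\<lambda>l. \<Sum>s\<in>S. c s * s l) = (\<Sum>s\<in>S. c s * pairing r u s)"
proof -
  have "pairing r u (\<lambda>l. \<Sum>s\<in>S. c s * s l) = (\<Sum>l<r. \<Sum>s\<in>S. c s * (u l * s l))"
    by (simp add: pairing_def sum_distrib_left mult_ac)
  also have "\<dots> = (\<Sum>s\<in>S. c s * pairing r u s)"
    by (subst sum.swap) (simp add: pairing_def sum_distrib_left)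
  finally show ?thesis .
qed

lemma submonoid_dual_monoid: "submonoid (dual_monoid r m C)"
  by (auto simp: submonoid_def dual_monoid_def M_pow_closed pairing_pow_def lookup_add of_rat_add
      pairing_add sum.distrib)

lemma dual_monoid_zero: "dual_monoid r m {\<lambda>j l. 0} = M_pow r m"
  by (auto simp: dual_monoid_def pairing_pow_def)

lemma prod_cone_zero: "prod_cone m (\<lambda>_. {\<lambda>l. 0}) = {\<lambda>j l. 0}"
  by (auto simp: prod_cone_def fun_eq_iff split: if_splits)

lemma zero_in_cone:
  assumes "fan r \<Sigma>" "\<sigma> \<in> \<Sigma>" shows "(\<lambda>l. 0) \<in> \<sigma>"
proof -
  obtain S where "\<sigma> = cone_generated S"
    using assms unfolding fan_def rational_polyhedral_cone_def by blast
  then show ?thesis by (auto simp: cone_generated_def intro!: exI[of _ "\<lambda>_. 0"])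
qed

lemma fan_Int: "fan r \<Sigma> \<Longrightarrow> \<sigma> \<in> \<Sigma> \<Longrightarrow> \<tau> \<in> \<Sigma> \<Longrightarrow> \<sigma> \<inter> \<tau> \<in> \<Sigma>"
  unfolding fan_def by blast

text \<open>
  The intersection of all cones is in the fan. If it contained \<open>v \<noteq> 0\<close>, then by completeness some
  cone would contain \<open>- v\<close> as well as \<open>v\<close>.
\<close>

lemma zero_cone_in_fan:
  assumes \<Sigma>: "complete_fan r \<Sigma>" shows "{\<lambda>l. 0} \<in> \<Sigma>"
proof -
  have fan: "fan r \<Sigma>" and un: "\<Union>\<Sigma> = NR r" using \<Sigma> by (auto simp: complete_fan_def)
  have fin: "finite \<Sigma>" using fan by (simp add: fan_def)
  have "(\<lambda>l. 0) \<in> NR r" by (simp add: NR_def)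
  then have ne: "\<Sigma> \<noteq> {}" using un by auto
  have "\<Inter>F \<in> \<Sigma>" if "finite F" "F \<noteq> {}" "F \<subseteq> \<Sigma>" for F
    using that by (induction F rule: finite_ne_induct) (auto intro: fan_Int[OF fan])
  then have I: "\<Inter>\<Sigma> \<in> \<Sigma>" using fin ne by blast
  have "v = (\<lambda>l. 0)" if v: "v \<in> \<Inter>\<Sigma>" for v
  proof -
    have "v \<in> NR r" using v I un by blast
    then have "(\<lambda>l. - v l) \<in> NR r" by (simp add: NR_def)
    then obtain \<sigma> where \<sigma>: "\<sigma> \<in> \<Sigma>" "(\<lambda>l. - v l) \<in> \<sigma>" using un by blast
    then have "strongly_convex \<sigma>" "v \<in> \<sigma>" using fan v by (auto simp: fan_def)
    then show ?thesis using \<sigma> unfolding strongly_convex_def by blast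
  qed
  then have "\<Inter>\<Sigma> = {\<lambda>l. 0}" using zero_in_cone[OF fan I] by blast
  then show ?thesis using I by simp
qed

text \<open>Rounding \<open>K * u\<close> down moves every coordinate by less than 1, so the pairing
  drops by at most the sum of the absolute values of the coordinates of \<open>s\<close>.\<close>

lemma pairing_floor_ge:
  "pairing r (\<lambda>l. of_int \<lfloor>K * u l\<rfloor>) s \<ge> K * pairing r u s - (\<Sum>l<r. \<bar>s l\<bar>)"
proof -
  have "K * pairing r u s - (\<Sum>l<r. \<bar>s l\<bar>) = (\<Sum>l<r. K * u l * s l - \<bar>s l\<bar>)"
    by (simp add: pairing_def sum_distrib_left sum_subtractf mult.assoc)
  also have "\<dots> \<le> (\<Sum>l<r. of_int \<lfloor>K * u l\<rfloor> * s l)"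
  proof (rule sum_mono)
    fix l
    let ?d = "K * u l - of_int \<lfloor>K * u l\<rfloor>"
    have "0 \<le> ?d" "?d \<le> 1" by linarith+
    then have "?d * s l \<le> \<bar>s l\<bar>"
      using mult_left_mono[of "s l" "\<bar>s l\<bar>" ?d] mult_right_mono[of ?d 1 "\<bar>s l\<bar>"] by linarith
    then show "K * u l * s l - \<bar>s l\<bar> \<le> of_int \<lfloor>K * u l\<rfloor> * s l" by (simp add: algebra_simps)
  qed
  finally show ?thesis by (simp add: pairing_def)
qed

text \<open>Since \<open>{0}\<close> is a face, the dual cone has interior points; far inside it there are lattice points.\<close>

lemma dual_cone_shift:
  assumes \<Sigma>: "complete_fan r \<Sigma>" and \<sigma>: "\<sigma> \<in> \<Sigma>"
  shows "\<exists>v :: nat \<Rightarrow> int. \<forall>x\<in>\<sigma>. 0 \<le> pairing r (\<lambda>l. of_int (v l)) x \<and>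
      0 \<le> pairing r (\<lambda>l. of_int (v l) + w l) x"
proof -
  have fan: "fan r \<Sigma>" using \<Sigma> by (simp add: complete_fan_def)
  obtain S where S: "finite S" "\<sigma> = cone_generated S"
    using fan \<sigma> unfolding fan_def rational_polyhedral_cone_def by blast
  have S\<sigma>: "s \<in> \<sigma>" if s: "s \<in> S" for s
    unfolding S(2) cone_generated_def
    using s S(1) by (intro CollectI exI[of _ "\<lambda>t. if t = s then 1 else 0"]) (auto simp: if_distrib[of "\<lambda>x. x * _"] cong: if_cong)
  have "is_face r (\<sigma> \<inter> {\<lambda>l. 0}) \<sigma>" using fan \<sigma> zero_cone_in_fan[OF \<Sigma>] unfolding fan_def by blast
  moreover have "\<sigma> \<inter> {\<lambda>l. 0} = {\<lambda>l. 0}" using zero_in_cone[OF fan \<sigma>] by blast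
  ultimately obtain u where u: "\<forall>v\<in>\<sigma>. 0 \<le> pairing r u v" "{\<lambda>l. 0} = {v \<in> \<sigma>. pairing r u v = 0}"
    unfolding is_face_def by auto
  \<comment> \<open>The face cut out by \<open>u\<close> is the zero cone, so \<open>u\<close> is
    positive on every nonzero generator.\<close>
  have pos: "pairing r u s > 0" if "s \<in> S" "s \<noteq> (\<lambda>l. 0)" for s
    using u S\<sigma> that by (metis (mono_tags, lifting) le_less mem_Collect_eq singletonD)
  \<comment> \<open>For the generator \<open>s\<close>, this multiple of \<open>u\<close> makes up
    for both the rounding loss and the value of \<open>w\<close>. The sum \<open>K\<close> then
    serves all generators at once.\<close>
  define K0 where "K0 s = ((\<Sum>l<r. \<bar>s l\<bar>) + \<bar>pairing r w s\<bar>) / pairing r u s" for s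
  define K where "K = (\<Sum>s\<in>S. \<bar>K0 s\<bar>)"
  define v where "v l = \<lfloor>K * u l\<rfloor>" for l
  have gen: "0 \<le> pairing r (\<lambda>l. of_int (v l)) s \<and> 0 \<le> pairing r (\<lambda>l. of_int (v l) + w l) s" if s: "s \<in> S" for s
  proof (cases "s = (\<lambda>l. 0)")
    case False
    have "\<bar>K0 s\<bar> \<le> K" unfolding K_def using S(1) s by (intro member_le_sum) auto
    then have "K0 s * pairing r u s \<le> K * pairing r u s"
      using pos[OF s False] by (intro mult_right_mono) auto
    then have "(\<Sum>l<r. \<bar>s l\<bar>) + \<bar>pairing r w s\<bar> \<le> K * pairing r u s"
      using pos[OF s False] by (simp add: K0_def)
    moreover have "0 \<le> (\<Sum>l<r. \<bar>s l\<bar>)" by (simp add: sum_nonneg)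
    ultimately show ?thesis using pairing_floor_ge[of K r u s] unfolding v_def pairing_add by linarith
  qed simp
  have "0 \<le> pairing r (\<lambda>l. of_int (v l)) x \<and> 0 \<le> pairing r (\<lambda>l. of_int (v l) + w l) x" if x: "x \<in> \<sigma>" for x
  proof -
    obtain c where c: "\<forall>s\<in>S. 0 \<le> c s" "x = (\<lambda>l. \<Sum>s\<in>S. c s * s l)"
      using x unfolding S(2) cone_generated_def by blast
    show ?thesis using c(1) gen unfolding c(2) pairing_sum by (auto intro!: sum_nonneg)
  qed
  then show ?thesis by blast
qed

lemma exists_expo:
  fixes v :: "nat \<Rightarrow> nat \<Rightarrow> int"
  shows "\<exists>u\<in>M_pow r m. \<forall>j\<in>{1..m}. \<forall>l<r. lkp (lkp u j) l = of_int (v j l)"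
proof -
  define u :: expo where
    "u = (\<Sum>j\<in>{1..m}. Poly_Mapping.single j (\<Sum>l<r. Poly_Mapping.single l (of_int (v j l))))"
  have "lkp (lkp u j) l = (if j \<in> {1..m} \<and> l < r then of_int (v j l) else 0)" for j l
  proof -
    have "lkp u j = (if j \<in> {1..m} then \<Sum>l<r. Poly_Mapping.single l (of_int (v j l)) else 0)"
      by (simp add: u_def lookup_sum lookup_single lookup_one when_def)
    then show ?thesis by (simp add: lookup_sum lookup_single lookup_one when_def)
  qed
  then show ?thesis by (intro bexI[of _ u]) (auto simp: M_pow_iff)
qed

text \<open>Pairing with a product of cones is computed factor by factor, so the shifts from
  \<open>dual_cone_shift\<close> are assembled into one exponent. This is the generation property
  demanded by \<open>monomial_charts\<close>.\<close>

lemma dual_monoid_generates: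
  assumes \<Sigma>: "complete_fan r \<Sigma>" and \<sigma>: "\<And>j. j \<in> {1..m} \<Longrightarrow> \<sigma> j \<in> \<Sigma>" and w: "w \<in> M_pow r m"
  shows "\<exists>v\<in>dual_monoid r m (prod_cone m \<sigma>). v + w \<in> dual_monoid r m (prod_cone m \<sigma>)"
proof -
  let ?w = "\<lambda>j l. of_rat (lkp (lkp w j) l) :: real"
  have "\<forall>j\<in>{1..m}. \<exists>v :: nat \<Rightarrow> int. \<forall>x\<in>\<sigma> j. 0 \<le> pairing r (\<lambda>l. of_int (v l)) x \<and>
      0 \<le> pairing r (\<lambda>l. of_int (v l) + ?w j l) x"
    by (intro ballI dual_cone_shift[OF \<Sigma> \<sigma>])
  from bchoice[OF this] obtain v :: "nat \<Rightarrow> nat \<Rightarrow> int" where v: "\<And>j x. j \<in> {1..m} \<Longrightarrow> x \<in> \<sigma> j \<Longrightarrow>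
      0 \<le> pairing r (\<lambda>l. of_int (v j l)) x \<and> 0 \<le> pairing r (\<lambda>l. of_int (v j l) + ?w j l) x"
    by blast
  obtain u where u: "u \<in> M_pow r m" "\<And>j l. j \<in> {1..m} \<Longrightarrow> l < r \<Longrightarrow> lkp (lkp u j) l = of_int (v j l)"
    using exists_expo[of r m v] by blast
  have "pairing r (\<lambda>l. of_rat (lkp (lkp u j) l)) x = pairing r (\<lambda>l. of_int (v j l)) x"
    "pairing r (\<lambda>l. of_rat (lkp (lkp (u + w) j) l)) x = pairing r (\<lambda>l. of_int (v j l) + ?w j l) x"
    if "j \<in> {1..m}" for j x
    using u(2)[OF that] by (auto simp: pairing_def lookup_add of_rat_add)
  then have "u \<in> dual_monoid r m (prod_cone m \<sigma>)" "u + w \<in> dual_monoid r m (prod_cone m \<sigma>)"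
    using u(1) w v by (auto simp: dual_monoid_def M_pow_closed pairing_pow_def prod_cone_def intro!: sum_nonneg)
  then show ?thesis by blast
qed

text \<open>The torus is the chart of the tuple of zero cones.\<close>

lemma monomial_charts_fan:
  assumes "complete_fan r \<Sigma>" "q > 0"
  shows "monomial_charts (charts r \<Sigma> n :: 'k::field alg set set) (M_pow r n) q"
proof
  have "prod_cone n (\<lambda>_. {\<lambda>l. 0}) \<in> prod_fan n \<Sigma>"
    using zero_cone_in_fan[OF assms(1)] unfolding prod_fan_def by blast
  then show "monoid_alg (M_pow r n) \<in> (charts r \<Sigma> n :: 'k alg set set)"
    unfolding charts_def prod_cone_zero
    by (intro image_eqI[of _ _ "{\<lambda>j l. 0}"]) (simp_all add: coord_ring_eq dual_monoid_zero)
next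
  fix A :: "'k alg set" assume "A \<in> charts r \<Sigma> n"
  then obtain \<sigma> where "\<And>j. j \<in> {1..n} \<Longrightarrow> \<sigma> j \<in> \<Sigma>" "A = monoid_alg (dual_monoid r n (prod_cone n \<sigma>))"
    unfolding charts_def prod_fan_def coord_ring_eq by blast
  then show "\<exists>S. A = monoid_alg S \<and> submonoid S \<and> S \<subseteq> M_pow r n \<and> (\<forall>w\<in>M_pow r n. \<exists>v\<in>S. v + w \<in> S)"
    using dual_monoid_generates[OF assms(1)] submonoid_dual_monoid
    by (intro exI[of _ "dual_monoid r n (prod_cone n \<sigma>)"]) (auto simp: dual_monoid_def)
qed (use assms in \<open>auto simp: submonoid_def M_pow_closed\<close>)

section \<open>Diagonals\<close>

text \<open>On M^n this is the map to M^(n-1) dual to repeating the \<open>i\<close>-th component.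
  Its kernel is L_i, so its values label the classes of M^n / L_i.\<close>

definition merge :: "nat \<Rightarrow> expo \<Rightarrow> expo" where "merge i = push (diag_index i)"

lemma merge_add: "merge i (u + v) = merge i u + merge i v"
  by (simp add: merge_def push_add)

lemma merge_diff: "merge i (u - v) = merge i u - merge i v"
  by (simp add: merge_def push_diff)

lemma merge_zero [simp]: "merge i 0 = 0"
  by (simp add: merge_def)

lemma lookup_merge:
  "lkp (merge i u) v = (if v < i then lkp u v else if v = i then lkp u i + lkp u (i + 1) else lkp u (v + 1))"
proof -
  have *: "{j. diag_index i j = v} = (if v < i then {v} else if v = i then {i, i + 1} else {v + 1})"
    by (auto simp: diag_index_def)
  then have "finite {j. diag_index i j = v}" by simp
  then have "lkp (merge i u) v = (\<Sum>j | diag_index i j = v. lkp u j)"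
    unfolding merge_def lookup_push by (intro sum.mono_neutral_left) (auto simp: in_keys_iff)
  then show ?thesis unfolding * by simp
qed

lemma merge_scale: "merge i (scale q u) = scale q (merge i u)"
  by (induction q) (simp_all add: scale_Suc merge_add)

text \<open>Away from positions \<open>i\<close> and \<open>i + 1\<close> merging only renumbers
  components, and at position \<open>i\<close> it forms their sum, which is the whole sum once the
  other components vanish.\<close>

lemma L_sub_iff:
  assumes i: "i \<in> {1..n-1}"
  shows "u \<in> L_sub r n i \<longleftrightarrow> u \<in> M_pow r n \<and> merge i u = 0"
proof -
  have sum: "(\<Sum>j=1..n. lkp u j) = lkp u i + lkp u (i + 1)" if "\<And>j. j \<notin> {i, i + 1} \<Longrightarrow> lkp u j = 0"
  proof -
    have "(\<Sum>j=1..n. lkp u j) = (\<Sum>j\<in>{i, i + 1}. lkp u j)"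
      using i that by (intro sum.mono_neutral_right) auto
    then show ?thesis by simp
  qed
  show ?thesis
  proof
    assume "u \<in> L_sub r n i"
    then have u: "u \<in> M_pow r n" "(\<Sum>j=1..n. lkp u j) = 0" "\<And>j. j \<notin> {i, i + 1} \<Longrightarrow> lkp u j = 0"
      unfolding L_sub_def by blast+
    have "merge i u = 0" by (rule poly_mapping_eqI) (use u sum[OF u(3)] in \<open>auto simp: lookup_merge\<close>)
    then show "u \<in> M_pow r n \<and> merge i u = 0" using u by simp
  next
    assume u: "u \<in> M_pow r n \<and> merge i u = 0"
    then have m: "lkp (merge i u) v = 0" for v by simp
    have z: "lkp u j = 0" if "j \<notin> {i, i + 1}" for j
    proof (cases "j < i")
      case True
      then show ?thesis using m[of j] by (simp add: lookup_merge)
    next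
      case False
      \<comment> \<open>A component beyond \<open>i + 1\<close> has been moved down by one
        position.\<close>
      then have "j - 1 > i" "j - 1 + 1 = j" using that by auto
      then show ?thesis using m[of "j - 1"] by (simp add: lookup_merge split: if_splits)
    qed
    have "lkp u i + lkp u (i + 1) = 0" using m[of i] by (simp only: lookup_merge) simp
    then show "u \<in> L_sub r n i" using u sum[OF z] z by (simp add: L_sub_def)
  qed
qed

section \<open>Ideals of the diagonals on the torus\<close>

abbreviation merge_alg :: "nat \<Rightarrow> 'k::field alg \<Rightarrow> 'k alg" where "merge_alg i \<equiv> push (merge i)"

lemma merge_alg_mult: "merge_alg i (f * g) = merge_alg i f * merge_alg i g"
  by (rule push_mult) (rule merge_add)

lemma merge_alg_frob: "merge_alg i (frob q f) = frob q (merge_alg i f)"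
  by (simp add: push_push comp_def merge_scale)

text \<open>The kernel of k[M^n] -> k[M^(n-1)], which is the ideal of Delta_i on the torus.\<close>

definition diag_ideal :: "nat \<Rightarrow> nat \<Rightarrow> nat \<Rightarrow> 'k::field alg set" where
  "diag_ideal r n i = {f \<in> monoid_alg (M_pow r n). merge_alg i f = 0}"

lemma prime_ideal_diag_ideal: "prime_ideal (monoid_alg (M_pow r n)) (diag_ideal r n i :: 'k::field alg set)"
proof -
  have "subring1 (monoid_alg (M_pow r n) :: 'k alg set)"
    by (intro subring1_monoid_alg) (auto simp: submonoid_def M_pow_closed)
  moreover have "merge_alg i (1 :: 'k alg) = 1" by (simp flip: single_one)
  ultimately show ?thesis
    by (auto simp: prime_ideal_def diag_ideal_def subring1D push_add merge_alg_mult)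
qed

text \<open>Points of the diagonal are given by preimages of primes under
  \<open>merge_alg i\<close>, and such a preimage contains the kernel.\<close>

lemma diagonal_on_closure:
  assumes "monomial_charts (charts r \<Sigma> n :: 'k::field alg set set) (M_pow r n) q"
    and i: "i \<in> {1..n-1}" and x: "(x :: 'k pt) \<in> diagonal r \<Sigma> n i"
  shows "monomial_charts.on_closure (charts r \<Sigma> n) (diag_ideal r n i) x"
proof -
  interpret monomial_charts "charts r \<Sigma> n :: 'k alg set set" "M_pow r n" q by fact
  obtain \<sigma> p where \<sigma>: "\<forall>j\<in>{1..n-1}. \<sigma> j \<in> \<Sigma>"
    and p: "prime_ideal (coord_ring r (n-1) (prod_cone (n-1) \<sigma>)) p"
    and x: "x = local_ring (coord_ring r n (prod_cone n (\<sigma> \<circ> diag_index i)))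
             {f \<in> coord_ring r n (prod_cone n (\<sigma> \<circ> diag_index i)). merge_alg i f \<in> p}"
    using x unfolding diagonal_def merge_def by blast
  have "(\<sigma> \<circ> diag_index i) j \<in> \<Sigma>" if "j \<in> {1..n}" for j
  proof -
    have "diag_index i j \<in> {1..n-1}" using i that by (auto simp: diag_index_def)
    then show ?thesis using \<sigma> by simp
  qed
  then have chart: "coord_ring r n (prod_cone n (\<sigma> \<circ> diag_index i)) \<in> charts r \<Sigma> n"
    unfolding charts_def prod_fan_def by blast
  show ?thesis
    unfolding on_closure_def x
  proof (intro bexI[OF _ chart] exI conjI)
    show "diag_ideal r n i \<inter> coord_ring r n (prod_cone n (\<sigma> \<circ> diag_index i))
        \<subseteq> {f \<in> coord_ring r n (prod_cone n (\<sigma> \<circ> diag_index i)). merge_alg i f \<in> p}"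
      using prime_idealD(2)[OF p] by (auto simp: diag_ideal_def)
  qed (rule refl)
qed

text \<open>This is the image of the generic point of the smaller torus: take zero cones throughout
  and the zero prime.\<close>

lemma generic_point_in_diagonal:
  assumes "complete_fan r \<Sigma>"
  shows "local_ring (monoid_alg (M_pow r n)) (diag_ideal r n i :: 'k::field alg set) \<in> diagonal r \<Sigma> n i"
proof -
  let ?\<sigma> = "\<lambda>_ :: nat. {\<lambda>l :: nat. 0 :: real}"
  have "?\<sigma> \<circ> diag_index i = ?\<sigma>" by (simp add: comp_def)
  then have "coord_ring r n (prod_cone n (?\<sigma> \<circ> diag_index i)) = (monoid_alg (M_pow r n) :: 'k alg set)"
    by (simp add: prod_cone_zero coord_ring_eq dual_monoid_zero)
  moreover have "prime_ideal (coord_ring r (n-1) (prod_cone (n-1) ?\<sigma>)) ({0} :: 'k alg set)"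
    by (auto simp: prime_ideal_def coord_ring_def)
  ultimately show ?thesis
    using zero_cone_in_fan[OF assms] unfolding diagonal_def
    by (intro CollectI exI[of _ ?\<sigma>] exI[of _ "{0}"]) (auto simp: diag_ideal_def merge_def)
qed

text \<open>The function t_j / t_(j+1) - 1, where t_j is the first torus coordinate of the
  \<open>j\<close>-th factor. It vanishes on Delta_j and on no other diagonal.\<close>

definition diag_binomial :: "nat \<Rightarrow> 'k::field alg" where
  "diag_binomial j = monomial (Poly_Mapping.single j (Poly_Mapping.single 0 1)
     - Poly_Mapping.single (j + 1) (Poly_Mapping.single 0 1)) - 1"

lemma diag_binomial_mem:
  assumes "r > 0" "j \<in> {1..n-1}"
  shows "(diag_binomial j :: 'k::field alg) \<in> monoid_alg (M_pow r n)"
    "(diag_binomial j :: 'k alg) \<in> diag_ideal r n i \<longleftrightarrow> i = j"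
proof -
  let ?e = "Poly_Mapping.single j (Poly_Mapping.single 0 1)
     - Poly_Mapping.single (j + 1) (Poly_Mapping.single 0 1) :: expo"
  have e: "?e \<in> M_pow r n"
    using assms by (auto simp: M_pow_iff lookup_minus lookup_single lookup_one when_def)
  have sub: "subring1 (monoid_alg (M_pow r n) :: 'k alg set)"
    by (intro subring1_monoid_alg) (auto simp: submonoid_def M_pow_closed)
  show mem: "(diag_binomial j :: 'k alg) \<in> monoid_alg (M_pow r n)"
    unfolding diag_binomial_def
    by (intro subring1D(6)[OF sub] subring1D(2)[OF sub] single_in_monoid_alg e)
  have "merge_alg i (diag_binomial j :: 'k alg) = monomial (merge i ?e) - monomial 0"
    by (simp add: diag_binomial_def push_diff flip: single_one)
  then have "merge_alg i (diag_binomial j :: 'k alg) = 0 \<longleftrightarrow> merge i ?e = 0"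
    by (metis lookup_single_eq lookup_single_not_eq one_neq_zero right_minus_eq)
  moreover have "merge i ?e = 0 \<longleftrightarrow> i = j"
  proof
    assume "merge i ?e = 0"
    then have "lkp (lkp (merge i ?e) v) 0 = 0" for v by simp
    \<comment> \<open>At the position to which component \<open>j\<close> is moved, the coefficient
      is 1 unless component \<open>j + 1\<close> is moved there too.\<close>
    from this[of "diag_index i j"] show "i = j"
      by (auto simp: lookup_merge lookup_minus lookup_add lookup_single lookup_one when_def diag_index_def split: if_splits)
  next
    show "i = j \<Longrightarrow> merge i ?e = 0"
      by (intro poly_mapping_eqI) (auto simp: lookup_merge lookup_minus lookup_single lookup_one when_def)
  qed
  ultimately show "(diag_binomial j :: 'k alg) \<in> diag_ideal r n i \<longleftrightarrow> i = j"
    using mem by (simp add: diag_ideal_def)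
qed

section \<open>The action on monomials\<close>

definition pi_sum :: "nat \<Rightarrow> nat \<Rightarrow> (expo \<Rightarrow>\<^sub>0 'k::field) \<Rightarrow> 'k alg \<Rightarrow> 'k alg" where
  "pi_sum r n c f = (\<Sum>a\<in>Poly_Mapping.keys c. Poly_Mapping.single 0 (lkp c a) * pi_a r n a f)"

definition pi_monomial :: "nat \<Rightarrow> nat \<Rightarrow> (expo \<Rightarrow>\<^sub>0 'k::field) \<Rightarrow> expo \<Rightarrow> 'k alg" where
  "pi_monomial r n c b =
     (\<Sum>a | a \<in> Poly_Mapping.keys c \<and> a + b \<in> M_pow r n. Poly_Mapping.single (a + b) (lkp c a))"

text \<open>The two sums are interchanged. The index set \<open>B\<close> may exceed the support, so
  that \<open>{b, b'}\<close> can be used for a binomial.\<close>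

lemma pi_sum_expand:
  assumes "finite B" "Poly_Mapping.keys f \<subseteq> B"
  shows "pi_sum r n c f = (\<Sum>b\<in>B. Poly_Mapping.single 0 (lkp f b) * pi_monomial r n c b)"
proof -
  let ?t = "\<lambda>a b. if a + b \<in> M_pow r n then Poly_Mapping.single (a + b) (lkp c a * lkp f b) else 0"
  have "pi_sum r n c f = (\<Sum>a\<in>Poly_Mapping.keys c. \<Sum>b\<in>Poly_Mapping.keys f. ?t a b)"
    by (simp add: pi_sum_def pi_a_def sum_distrib_left mult_single sum.inter_filter if_distrib cong: if_cong)
  also have "\<dots> = (\<Sum>b\<in>Poly_Mapping.keys f. \<Sum>a\<in>Poly_Mapping.keys c. ?t a b)"
    by (rule sum.swap)
  also have "\<dots> = (\<Sum>b\<in>Poly_Mapping.keys f. Poly_Mapping.single 0 (lkp f b) * pi_monomial r n c b)"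
    by (simp add: pi_monomial_def sum_distrib_left mult_single sum.inter_filter if_distrib mult.commute cong: if_cong)
  also have "\<dots> = (\<Sum>b\<in>B. Poly_Mapping.single 0 (lkp f b) * pi_monomial r n c b)"
    using assms by (intro sum.mono_neutral_left) (auto simp: in_keys_iff)
  finally show ?thesis .
qed

lemma pi_monomial_mem: "pi_monomial r n c b \<in> monoid_alg (M_pow r n)"
  unfolding pi_monomial_def
  by (intro subring1_sum subring1_monoid_alg single_in_monoid_alg) (auto simp: submonoid_def M_pow_closed)

lemma pi_sum_mem: "pi_sum r n c f \<in> monoid_alg (M_pow r n)"
proof -
  have M: "submonoid (M_pow r n)" by (auto simp: submonoid_def M_pow_closed)
  show ?thesis
    unfolding pi_sum_expand[OF finite_keys order_refl]
    by (intro subring1_sum subring1D(4) subring1_monoid_alg[OF M] single_in_monoid_alg pi_monomial_mem M_pow_closed)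
qed

text \<open>These coefficients are the sums of the theorem, with a class modulo L_i given by the
  value \<open>x\<close> of \<open>merge i\<close>.\<close>

lemma lookup_merge_pi_monomial:
  "lkp (merge_alg i (pi_monomial r n c b)) x =
    (\<Sum>a | a \<in> Poly_Mapping.keys c \<and> a + b \<in> M_pow r n \<and> merge i (a + b) = x. lkp c a)"
proof -
  have "lkp (merge_alg i (pi_monomial r n c b)) x =
      (\<Sum>a | a \<in> Poly_Mapping.keys c \<and> a + b \<in> M_pow r n. if merge i (a + b) = x then lkp c a else 0)"
    by (simp add: pi_monomial_def push_sum lookup_sum lookup_single lookup_one when_def)
  also have "\<dots> = (\<Sum>a | a \<in> {a. a \<in> Poly_Mapping.keys c \<and> a + b \<in> M_pow r n} \<and> merge i (a + b) = x. lkp c a)"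
    by (rule sum.inter_filter[symmetric]) simp
  finally show ?thesis by (simp add: conj_assoc)
qed

lemma merge_alg_pi_sum:
  assumes "finite B" "Poly_Mapping.keys f \<subseteq> B"
  shows "merge_alg i (pi_sum r n c f) =
    (\<Sum>b\<in>B. Poly_Mapping.single 0 (lkp f b) * merge_alg i (pi_monomial r n c b))"
  by (simp add: pi_sum_expand[OF assms] push_sum merge_alg_mult)

text \<open>One direction tests the kernel on binomials x^b - x^b'. Conversely, grouping the terms
  of \<open>f\<close> by their classes leaves the coefficients of \<open>merge_alg i f\<close> as
  factors, and these vanish.\<close>

lemma kernel_preserved_iff:
  fixes c :: "expo \<Rightarrow>\<^sub>0 'k::field"
  shows "(\<forall>f. Poly_Mapping.keys f \<subseteq> S \<and> merge_alg i f = 0 \<longrightarrow> merge_alg i (pi_sum r n c f) = 0) \<longleftrightarrow>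
    (\<forall>b\<in>S. \<forall>b'\<in>S. merge i b = merge i b' \<longrightarrow>
        merge_alg i (pi_monomial r n c b) = merge_alg i (pi_monomial r n c b'))"
  (is "?L \<longleftrightarrow> ?R")
proof
  assume L: ?L
  show ?R
  proof (intro ballI impI)
    fix b b' assume b: "b \<in> S" "b' \<in> S" "merge i b = merge i b'"
    show "merge_alg i (pi_monomial r n c b) = merge_alg i (pi_monomial r n c b')"
    proof (cases "b = b'")
      case False
      let ?f = "monomial b - monomial b' :: 'k alg"
      have k: "Poly_Mapping.keys ?f \<subseteq> {b, b'}"
        by (auto simp: in_keys_iff lookup_minus lookup_single lookup_one when_def split: if_splits)
      moreover have "merge_alg i ?f = 0" using b by (simp add: push_diff)
      ultimately have "merge_alg i (pi_sum r n c ?f) = 0" using L b by blast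
      then show ?thesis
        using False by (simp add: merge_alg_pi_sum[OF _ k] lookup_minus lookup_single single_uminus)
    qed simp
  qed
next
  assume R: ?R
  show ?L
  proof (intro allI impI)
    fix f :: "'k alg" assume f: "Poly_Mapping.keys f \<subseteq> S \<and> merge_alg i f = 0"
    let ?K = "Poly_Mapping.keys f"
    \<comment> \<open>One exponent of \<open>f\<close> from every class; by \<open>?R\<close> its
      image stands for the whole class.\<close>
    define rep where "rep v = (SOME b. b \<in> ?K \<and> merge i b = v)" for v
    have rep: "rep (merge i b) \<in> ?K \<and> merge i (rep (merge i b)) = merge i b" if "b \<in> ?K" for b
      unfolding rep_def using someI[of "\<lambda>b'. b' \<in> ?K \<and> merge i b' = merge i b" b] that by simp
    let ?H = "\<lambda>v. merge_alg i (pi_monomial r n c (rep v))"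
    have "merge_alg i (pi_sum r n c f) = (\<Sum>b\<in>?K. Poly_Mapping.single 0 (lkp f b) * ?H (merge i b))"
      unfolding merge_alg_pi_sum[OF finite_keys order_refl]
    proof (intro sum.cong refl arg_cong2[where f = "(*)"])
      fix b assume "b \<in> ?K"
      then show "merge_alg i (pi_monomial r n c b) = ?H (merge i b)"
        using R rep[of b] f by (metis subsetD)
    qed
    also have "\<dots> = (\<Sum>v\<in>merge i ` ?K. \<Sum>b | b \<in> ?K \<and> merge i b = v. Poly_Mapping.single 0 (lkp f b) * ?H (merge i b))"
      by (rule sum.image_gen) simp
    also have "\<dots> = (\<Sum>v\<in>merge i ` ?K. Poly_Mapping.single 0 (lkp (merge_alg i f) v) * ?H v)"
    proof (intro sum.cong refl)
      fix v
      have "(\<Sum>b | b \<in> ?K \<and> merge i b = v. Poly_Mapping.single 0 (lkp f b)) =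
          Poly_Mapping.single (0::expo) (lkp (merge_alg i f) v)"
        unfolding lookup_push by (rule poly_mapping_eqI) (auto simp: lookup_sum lookup_single lookup_one when_def)
      then show "(\<Sum>b | b \<in> ?K \<and> merge i b = v. Poly_Mapping.single 0 (lkp f b) * ?H (merge i b)) =
          Poly_Mapping.single 0 (lkp (merge_alg i f) v) * ?H v"
        by (simp flip: sum_distrib_right cong: conj_cong)
    qed
    also have "\<dots> = 0" using f by simp
    finally show "merge_alg i (pi_sum r n c f) = 0" .
  qed
qed

text \<open>Congruence modulo (1/q) L_i is equality under \<open>merge i\<close>, since
  \<open>merge i\<close> commutes with the injective map \<open>scale q\<close>. The sums are the
  coefficients found in \<open>lookup_merge_pi_monomial\<close>.\<close>

lemma coefficient_condition_iff:
  fixes c :: "expo \<Rightarrow>\<^sub>0 'k::field"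
  assumes i: "i \<in> {1..n-1}" and c: "Poly_Mapping.keys c \<subseteq> frac_lattice q (M_pow r n)" and q: "q > 0"
    and b: "b \<in> frac_lattice q (M_pow r n)" "b' \<in> frac_lattice q (M_pow r n)"
  shows "(b - b' \<in> frac_lattice q (L_sub r n i) \<longrightarrow>
       (\<forall>u\<in>M_pow r n.
          (\<Sum>a | a \<in> Poly_Mapping.keys c \<and> a \<in> frac_lattice q (M_pow r n) \<and>
                 a + b \<in> M_pow r n \<and> (a + b) - u \<in> L_sub r n i. lkp c a)
        = (\<Sum>a' | a' \<in> Poly_Mapping.keys c \<and> a' \<in> frac_lattice q (M_pow r n) \<and>
                 a' + b' \<in> M_pow r n \<and> (a' + b') - u \<in> L_sub r n i. lkp c a'))) \<longleftrightarrow>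
     (merge i b = merge i b' \<longrightarrow>
       merge_alg i (pi_monomial r n c b) = merge_alg i (pi_monomial r n c b'))"
proof -
  have scale_inject: "scale q u = scale q v \<longleftrightarrow> u = v" for u v
    using unscale_scale[OF q] by metis
  have "b - b' \<in> frac_lattice q (L_sub r n i) \<longleftrightarrow> merge i b = merge i b'"
    using b by (simp add: frac_lattice_def L_sub_iff[OF i] scale_diff M_pow_closed merge_diff merge_scale scale_inject)
  moreover have set_eq: "{a. a \<in> Poly_Mapping.keys c \<and> a \<in> frac_lattice q (M_pow r n) \<and>
        a + b \<in> M_pow r n \<and> (a + b) - u \<in> L_sub r n i} =
      {a. a \<in> Poly_Mapping.keys c \<and> a + b \<in> M_pow r n \<and> merge i (a + b) = merge i u}"
    if "u \<in> M_pow r n" for u b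
    using c that by (auto simp: L_sub_iff[OF i] merge_diff M_pow_closed)
  have "(\<forall>u\<in>M_pow r n. lkp (merge_alg i (pi_monomial r n c b)) (merge i u) =
        lkp (merge_alg i (pi_monomial r n c b')) (merge i u)) \<longleftrightarrow>
      merge_alg i (pi_monomial r n c b) = merge_alg i (pi_monomial r n c b')" (is "?A \<longleftrightarrow> ?B")
  proof
    assume A: ?A
    show ?B
    proof (rule poly_mapping_eqI)
      fix x
      show "lkp (merge_alg i (pi_monomial r n c b)) x = lkp (merge_alg i (pi_monomial r n c b')) x"
      \<comment> \<open>The classes of M^n only reach coefficients at exponents in the image of
        \<open>merge i\<close>; at all others both sums are empty.\<close>
      proof (cases "x \<in> merge i ` M_pow r n")
        case False
        then have *: "{a. a \<in> Poly_Mapping.keys c \<and> a + b'' \<in> M_pow r n \<and> merge i (a + b'') = x} = {}" for b''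
          by blast
        show ?thesis unfolding lookup_merge_pi_monomial * by simp
      qed (use A in auto)
    qed
  qed auto
  ultimately show ?thesis
    by (simp add: set_eq flip: lookup_merge_pi_monomial cong: ball_cong)
qed

section \<open>Passing between exponents in (1/q) M^n and in M^n\<close>

lemma keys_unfrob:
  assumes "q > 0" "f \<in> monoid_alg L" shows "Poly_Mapping.keys (unfrob q f) \<subseteq> frac_lattice q L"
proof
  fix u assume "u \<in> Poly_Mapping.keys (unfrob q f)"
  then obtain v where "u = unscale q v" "v \<in> L"
    using keys_push[of "unscale q" f] assms(2) unfolding monoid_alg_def by blast
  then show "u \<in> frac_lattice q L" using assms(1) by (simp add: frac_lattice_def)
qed

lemma frob_in_monoid_alg_iff:
  assumes "q > 0"
  shows "frob q f \<in> monoid_alg L \<longleftrightarrow> Poly_Mapping.keys f \<subseteq> frac_lattice q L"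
proof
  show "frob q f \<in> monoid_alg L \<Longrightarrow> Poly_Mapping.keys f \<subseteq> frac_lattice q L"
    using keys_unfrob[OF assms, of "frob q f" L] assms by simp
  show "Poly_Mapping.keys f \<subseteq> frac_lattice q L \<Longrightarrow> frob q f \<in> monoid_alg L"
    using keys_push[of "scale q" f] unfolding monoid_alg_def frac_lattice_def by blast
qed

text \<open>The section x^(qb) of the direct image is written x^b on the right. The kernel condition
  is the same in both notations because \<open>merge_alg i\<close> commutes with the injective
  \<open>frob q\<close>.\<close>

lemma diag_ideal_preserved_iff:
  fixes c :: "expo \<Rightarrow>\<^sub>0 'k::field"
  assumes q: "q > 0"
  shows "(\<forall>f\<in>diag_ideal r n i. pi_sum r n c (unfrob q f) \<in> diag_ideal r n i) \<longleftrightarrow>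
    (\<forall>f. Poly_Mapping.keys f \<subseteq> frac_lattice q (M_pow r n) \<and> merge_alg i f = 0 \<longrightarrow>
      merge_alg i (pi_sum r n c f) = 0)" (is "?L \<longleftrightarrow> ?R")
proof
  assume L: ?L
  show ?R
  proof (intro allI impI)
    fix f :: "'k alg" assume "Poly_Mapping.keys f \<subseteq> frac_lattice q (M_pow r n) \<and> merge_alg i f = 0"
    then have "frob q f \<in> diag_ideal r n i"
      using frob_in_monoid_alg_iff[OF q] by (auto simp: diag_ideal_def merge_alg_frob)
    then show "merge_alg i (pi_sum r n c f) = 0" using L q by (fastforce simp: diag_ideal_def)
  qed
next
  assume R: ?R
  show ?L
  proof
    fix f :: "'k alg" assume f: "f \<in> diag_ideal r n i"
    then have "frob q (merge_alg i (unfrob q f)) = 0"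
      using q by (simp add: diag_ideal_def flip: merge_alg_frob)
    then have "merge_alg i (unfrob q f) = 0" using q by simp
    moreover have "Poly_Mapping.keys (unfrob q f) \<subseteq> frac_lattice q (M_pow r n)"
      using f keys_unfrob[OF q] by (auto simp: diag_ideal_def)
    ultimately show "pi_sum r n c (unfrob q f) \<in> diag_ideal r n i"
      using R pi_sum_mem by (simp add: diag_ideal_def)
  qed
qed

lemma prime_ideal_prod:
  assumes "prime_ideal A p" "subring1 A" "\<And>i. i \<in> I \<Longrightarrow> f i \<in> A \<and> f i \<notin> p"
  shows "prod f I \<notin> p"
  using assms(3)
proof (induction I rule: infinite_finite_induct)
  case (insert i I)
  then show ?case using prime_idealD(7)[OF assms(1)] subring1_prod[OF assms(2), of I f] by simp
qed (use assms(1) in \<open>auto simp: prime_idealD\<close>)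

theorem theorem7p3:
  fixes r q n :: nat
    and \<Sigma> :: "vec set set"
    and \<pi> :: "'k::field sheaf_map"
    and c :: "expo \<Rightarrow>\<^sub>0 'k"
  assumes "complete_fan r \<Sigma>"
    and "q \<ge> 2" and "n \<ge> 2"
    and "splitting q (charts r \<Sigma> n) \<pi>"
    and "given_by q r n \<pi> c"
  shows "compatible q (charts r \<Sigma> n) \<pi> (\<Union>i\<in>{1..n-1}. diagonal r \<Sigma> n i) \<longleftrightarrow>
    (\<forall>i\<in>{1..n-1}. \<forall>b\<in>frac_lattice q (M_pow r n). \<forall>b'\<in>frac_lattice q (M_pow r n).
       b - b' \<in> frac_lattice q (L_sub r n i) \<longrightarrow>
       (\<forall>u\<in>M_pow r n.
          (\<Sum>a | a \<in> Poly_Mapping.keys c \<and> a \<in> frac_lattice q (M_pow r n) \<and>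
                 a + b \<in> M_pow r n \<and> (a + b) - u \<in> L_sub r n i.
             Poly_Mapping.lookup c a)
        = (\<Sum>a' | a' \<in> Poly_Mapping.keys c \<and> a' \<in> frac_lattice q (M_pow r n) \<and>
                 a' + b' \<in> M_pow r n \<and> (a' + b') - u \<in> L_sub r n i.
             Poly_Mapping.lookup c a')))"
    (is "?compatible \<longleftrightarrow> ?coefficients")
proof -
  have q: "q > 0" using assms(2) by simp
  have c: "Poly_Mapping.keys c \<subseteq> frac_lattice q (M_pow r n)" using assms(5) by (simp add: given_by_def)
  interpret monomial_charts "charts r \<Sigma> n :: 'k alg set set" "M_pow r n" q
    by (rule monomial_charts_fan[OF assms(1) q])
  have \<pi>: "module_map q (charts r \<Sigma> n) \<pi>" using assms(4) by (simp add: splitting_def)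
  have torus: "torus r n = (torus_pts :: 'k pt set)"
    by (simp add: torus_def coord_ring_eq dual_monoid_zero A0_def)
  \<comment> \<open>The torus section x^(qb) is turned into x^b by \<open>unfrob q\<close>, the
    notation in which \<open>given_by\<close> describes the splitting.\<close>
  define P where "P f = pi_sum r n c (unfrob q f)" for f
  have P: "P f \<in> A0 \<and> \<pi> torus_pts (torus_sec f) = torus_sec (P f)" if f: "f \<in> A0" for f
  proof -
    have "Poly_Mapping.keys (unfrob q f) \<subseteq> frac_lattice q (M_pow r n)"
      using f keys_unfrob[OF q] by (simp add: A0_def)
    then have "\<pi> (torus r n) (torus_section r n (frob q (unfrob q f))) = torus_section r n (P f)"
      using assms(5) unfolding given_by_def P_def pi_sum_def by blast
    then show ?thesis using q by (simp add: torus_section_def torus P_def A0_def pi_sum_mem)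
  qed
  note I = prime_ideal_diag_ideal[of r n, where 'k = 'k, folded A0_def]
  have frob_I: "frob q f \<in> diag_ideal r n i \<longleftrightarrow> f \<in> diag_ideal r n i" if "f \<in> A0" for f i
    using that q frob_in_chart[OF A0_chart] by (auto simp: diag_ideal_def merge_alg_frob A0_def)
  note Z = diagonal_on_closure[OF monomial_charts_axioms]
  note \<eta> = generic_point_in_diagonal[OF assms(1), where 'k = 'k and n = n, folded A0_def]
  have ideal_iff: "(\<forall>f\<in>diag_ideal r n i. P f \<in> diag_ideal r n i) \<longleftrightarrow>
      (\<forall>b\<in>frac_lattice q (M_pow r n). \<forall>b'\<in>frac_lattice q (M_pow r n). merge i b = merge i b' \<longrightarrow>
        merge_alg i (pi_monomial r n c b) = merge_alg i (pi_monomial r n c b'))" for i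
    unfolding P_def diag_ideal_preserved_iff[OF q] kernel_preserved_iff ..
  have coeff: "?coefficients \<longleftrightarrow> (\<forall>i\<in>{1..n-1}. \<forall>f\<in>diag_ideal r n i. P f \<in> diag_ideal r n i)"
    unfolding ideal_iff by (intro ball_cong refl coefficient_condition_iff[OF _ c q])
  have "?compatible \<longleftrightarrow> (\<forall>i\<in>{1..n-1}. \<forall>f\<in>diag_ideal r n i. P f \<in> diag_ideal r n i)"
  proof
    assume R: "\<forall>i\<in>{1..n-1}. \<forall>f\<in>diag_ideal r n i. P f \<in> diag_ideal r n i"
    show ?compatible
      by (rule compatible_closures_if[where P = P, OF \<pi> P I frob_I Z \<eta>]) (use R in auto)
  next
    assume comp: ?compatible
    show "\<forall>i\<in>{1..n-1}. \<forall>f\<in>diag_ideal r n i. P f \<in> diag_ideal r n i"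
    proof (cases "r = 0")
      case True
      \<comment> \<open>In rank zero there are no separating binomials, but 0 is the only exponent,
        so the monomial form of the condition is trivial.\<close>
      have "b = 0" if "b \<in> frac_lattice q (M_pow r n)" for b
        using that q True by (intro expo_eqI) (simp add: M_pow_iff frac_lattice_def)
      then show ?thesis unfolding ideal_iff by metis
    next
      case False
      show ?thesis
      proof (intro ballI)
        fix i and f :: "'k alg" assume i: "i \<in> {1..n-1}" and f: "f \<in> diag_ideal r n i"
        \<comment> \<open>The product of the binomials of all other diagonals: the separating
          function that \<open>compatible_closures_only_if\<close> asks for.\<close>
        define g :: "'k alg" where "g = (\<Prod>j\<in>{1..n-1} - {i}. diag_binomial j)"
        have mem: "diag_binomial j \<in> A0" if "j \<in> {1..n-1}" for j
          using diag_binomial_mem(1)[of r j n] that False by (simp add: A0_def)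
        have mem_I: "(diag_binomial j :: 'k alg) \<in> diag_ideal r n j' \<longleftrightarrow> j' = j" if "j \<in> {1..n-1}" for j j'
          using diag_binomial_mem(2)[of r j n] that False by simp
        have "g \<in> A0" unfolding g_def using mem by (intro subring1_prod[OF A0_subring]) auto
        moreover have "g \<notin> diag_ideal r n i"
          unfolding g_def using mem mem_I by (intro prime_ideal_prod[OF I A0_subring]) auto
        moreover have "g \<in> diag_ideal r n j" if j: "j \<in> {1..n-1}" "j \<noteq> i" for j
        proof -
          have "g = diag_binomial j * (\<Prod>j\<in>{1..n-1} - {i} - {j}. diag_binomial j)"
            unfolding g_def using j by (intro prod.remove) auto
          moreover have "(\<Prod>j\<in>{1..n-1} - {i} - {j}. diag_binomial j :: 'k alg) \<in> A0"
            using mem by (intro subring1_prod[OF A0_subring]) auto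
          ultimately show ?thesis using prime_idealD(6)[OF I] mem_I[OF j(1)] by simp
        qed
        ultimately show "P f \<in> diag_ideal r n i"
          by (intro compatible_closures_only_if[where P = P, OF \<pi> P I frob_I Z \<eta> comp i _ _ _ f]) auto
      qed
    qed
  qed
  then show ?thesis unfolding coeff .
qed

end
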